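(* Let $G$ be an acylindrically hyperbolic group with trivial finite radical, and let $\alpha\colon G\curvearrowright A$ be an action on a unital $\mathrm{C}^*$-algebra that admits a Powers state $\phi\in S(A)$, such that $K:=\ker(\alpha)$ is nontrivial. Then $\alpha$ has the $\mathrm{PHP}$ property with respect to $\phi$.
   Context: A (discrete) group is acylindrically hyperbolic if it admits a non-elementary acylindrical action on a Gromov hyperbolic metric space (equivalently, such an action that is moreover cobounded). The finite radical is the maximal finite normal subgroup. $S(A)$ is the state space of $A$. Powers state. For an action $\alpha\colon G\curvearrowright A$ of a discrete group on a unital $\mathrm{C}^*$-algebra, a state $\phi\in S(A)$ is a Powers state for $\alpha$ (and $\alpha$ is said to admit the Powers state $\phi$) if for any finite $F\subseteq A$ and any $\varepsilon>0$ there is a finitely supported probability measure $\mu\in\mathrm{Prob}(G)$ with $\max_{a\in F}\big\|\sum_{g\in G}\mu(g)\alpha_g(a)-\phi(a)1_A\big\|<\varepsilon$. $\mathrm{PHP}$ property. Let $G$ be a discrete group, $A$ a unital $\mathrm{C}^*$-algebra and $\phi$ a state on $A$. A map $\alpha\colon G\to\mathrm{Aut}(A)$ has the $\mathrm{PHP}$ property with respect to $\phi$ if for every finite $F_A\subseteq A$, finite $F_G\subseteq G$, $N\in\mathbb{N}$ and $\varepsilon>0$, there exist $n\ge N$, $t_i\in G$ and $C_i\subseteq D_i\subseteq G$ for $1\le i\le n$ such that: (i) the subsets $\{gC_i: g\in F_G,\ i=1,\dots,n\}\cup\{ht_j^{-1}(G\setminus D_j): h\in F_G,\ j=1,\dots,n\}$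 (as a family indexed by the pairs $(g,i)$ and $(h,j)$) are pairwise disjoint; (ii) $\sup_{g\in G}|\{i: g\in D_i\}\cup\{j: g\in t_j^{-1}(G\setminus C_j)\}|\le\varepsilon n^{1/2}$; (iii) $\max_{a\in F_A}\big\|\frac{1}{2n}\sum_{i=1}^n(\alpha_{t_i}(a)+\alpha_{t_i}^{-1}(a))-\phi(a)1_A\big\|<\varepsilon$. *)

theory Defs
  imports "HOL-Probability.Probability" "HOL-Algebra.Group_Action"
begin

section \<open>Unital C*-algebras, automorphisms and states\<close>

text \<open>
  The superclass \<^class>\<open>real_normed_algebra_1\<close> contains \<open>norm 1 = 1\<close>, so the zero algebra is
  excluded; it has no states.
\<close>

class unital_cstar_algebra = real_normed_algebra_1 + banach +
  fixes scaleC :: "complex \<Rightarrow> 'a \<Rightarrow> 'a"  (infixr \<open>*\<^sub>C\<close> 75)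
    and star :: "'a \<Rightarrow> 'a"
  assumes scaleC_add_right: "c *\<^sub>C (x + y) = c *\<^sub>C x + c *\<^sub>C y"
    and scaleC_add_left: "(c + c') *\<^sub>C x = c *\<^sub>C x + c' *\<^sub>C x"
    and scaleC_scaleC: "c *\<^sub>C c' *\<^sub>C x = (c * c') *\<^sub>C x"
    and scaleC_complex_of_real: "complex_of_real r *\<^sub>C x = r *\<^sub>R x"
    and mult_scaleC_left: "(c *\<^sub>C x) * y = c *\<^sub>C (x * y)"
    and mult_scaleC_right: "x * (c *\<^sub>C y) = c *\<^sub>C (x * y)"
    and norm_scaleC: "norm (c *\<^sub>C x) = cmod c * norm x"
    and star_star: "star (star x) = x"
    and star_add: "star (x + y) = star x + star y"
    and star_mult: "star (x * y) = star y * star x"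
    and star_scaleC: "star (c *\<^sub>C x) = cnj c *\<^sub>C star x"
    and cstar_identity: "norm (star x * x) = (norm x)\<^sup>2"

instantiation complex :: unital_cstar_algebra
begin

definition scaleC_complex :: "complex \<Rightarrow> complex \<Rightarrow> complex" where
  "scaleC_complex c x = c * x"

definition star_complex :: "complex \<Rightarrow> complex" where
  "star_complex x = cnj x"

instance
  by standard
    (simp_all add: scaleC_complex_def star_complex_def algebra_simps norm_mult
      power2_eq_square scaleR_conv_of_real)

end

lemma vector_space_scaleC: "vector_space (scaleC :: complex \<Rightarrow> 'a::unital_cstar_algebra \<Rightarrow> 'a)"
proof
  fix x :: 'a
  show "1 *\<^sub>C x = x"
    using scaleC_complex_of_real[of 1 x] by simp
qed (simp_all add: scaleC_add_right scaleC_add_left scaleC_scaleC)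

definition star_automorphism :: "('a::unital_cstar_algebra \<Rightarrow> 'a) \<Rightarrow> bool" where
  "star_automorphism f \<longleftrightarrow>
     bij f \<and> Vector_Spaces.linear scaleC scaleC f \<and>
     (\<forall>x y. f (x * y) = f x * f y) \<and> (\<forall>x. f (star x) = star (f x))"

definition cstar_Aut :: "('a::unital_cstar_algebra \<Rightarrow> 'a) monoid" where
  "cstar_Aut = \<lparr>carrier = {f. star_automorphism f}, mult = (\<circ>), one = id\<rparr>"

lemma group_cstar_Aut: "group (cstar_Aut :: ('a::unital_cstar_algebra \<Rightarrow> 'a) monoid)"
proof (rule groupI)
  interpret vector_space_pair "scaleC :: complex \<Rightarrow> 'a \<Rightarrow> 'a" "scaleC :: complex \<Rightarrow> 'a \<Rightarrow> 'a"
    by (simp add: vector_space_pair_def vector_space_scaleC)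
  show "\<one>\<^bsub>cstar_Aut\<^esub> \<in> carrier (cstar_Aut :: ('a \<Rightarrow> 'a) monoid)"
    by (simp add: cstar_Aut_def star_automorphism_def vs1.linear_id)
  show "f \<otimes>\<^bsub>cstar_Aut\<^esub> g \<in> carrier cstar_Aut"
    if "f \<in> carrier cstar_Aut" "g \<in> carrier cstar_Aut" for f g :: "'a \<Rightarrow> 'a"
    using that
    by (auto simp: cstar_Aut_def star_automorphism_def bij_comp intro: Vector_Spaces.linear_compose)
  show "\<exists>g\<in>carrier cstar_Aut. g \<otimes>\<^bsub>cstar_Aut\<^esub> f = \<one>\<^bsub>cstar_Aut\<^esub>"
    if "f \<in> carrier cstar_Aut" for f :: "'a \<Rightarrow> 'a"
  proof -
    from that have f: "bij f" "Vector_Spaces.linear scaleC scaleC f"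
      "\<And>x y. f (x * y) = f x * f y" "\<And>x. f (star x) = star (f x)"
      by (auto simp: cstar_Aut_def star_automorphism_def)
    have inv_eqI: "inv_into UNIV f y = x" if "f x = y" for x y
      using that f(1) by (metis bij_is_inj inv_f_f)
    have surj: "f (inv_into UNIV f y) = y" for y
      using f(1) by (simp add: bij_is_surj surj_f_inv_f)
    have "Vector_Spaces.linear scaleC scaleC (inv_into UNIV f)"
      unfolding Vector_Spaces.linear_iff
      by (intro conjI allI vector_space_scaleC inv_eqI)
        (use f(2) in \<open>simp_all add: Vector_Spaces.linear_iff surj\<close>)
    moreover have "inv_into UNIV f (x * y) = inv_into UNIV f x * inv_into UNIV f y" for x y
      by (rule inv_eqI) (simp add: f(3) surj)
    moreover have "inv_into UNIV f (star x) = star (inv_into UNIV f x)" for x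
      by (rule inv_eqI) (simp add: f(4) surj)
    ultimately have "inv_into UNIV f \<in> carrier cstar_Aut"
      using f(1) by (simp add: cstar_Aut_def star_automorphism_def bij_imp_bij_inv)
    moreover have "inv_into UNIV f \<circ> f = id"
      using f(1) by (simp add: bij_is_inj)
    ultimately show ?thesis
      by (auto simp: cstar_Aut_def)
  qed
qed (auto simp: cstar_Aut_def)

definition state :: "('a::unital_cstar_algebra \<Rightarrow> complex) \<Rightarrow> bool" where
  "state \<phi> \<longleftrightarrow>
     Vector_Spaces.linear scaleC (*) \<phi> \<and> (\<forall>x. \<phi> (star x * x) \<in> \<real>\<^sub>\<ge>\<^sub>0) \<and> \<phi> 1 = 1"


section \<open>Acylindrically hyperbolic groups\<close>

definition gromov_product :: "('x \<Rightarrow> 'x \<Rightarrow> real) \<Rightarrow> 'x \<Rightarrow> 'x \<Rightarrow> 'x \<Rightarrow> real" where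
  "gromov_product d w x y = (d x w + d y w - d x y) / 2"

definition gromov_hyperbolic :: "'x set \<Rightarrow> ('x \<Rightarrow> 'x \<Rightarrow> real) \<Rightarrow> bool" where
  "gromov_hyperbolic X d \<longleftrightarrow>
     Metric_space X d \<and>
     (\<exists>\<delta>\<ge>0. \<forall>w\<in>X. \<forall>x\<in>X. \<forall>y\<in>X. \<forall>z\<in>X.
        gromov_product d w x z \<ge> min (gromov_product d w x y) (gromov_product d w y z) - \<delta>)"

text \<open>
  The sequential Gromov boundary: sequences converging to infinity, up to equivalence.  On a
  hyperbolic space both conditions below are independent of the base point \<open>w\<close>.
\<close>

definition converges_to_infinity :: "'x set \<Rightarrow> ('x \<Rightarrow> 'x \<Rightarrow> real) \<Rightarrow> (nat \<Rightarrow> 'x) \<Rightarrow> bool" where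
  "converges_to_infinity X d s \<longleftrightarrow>
     range s \<subseteq> X \<and>
     (\<forall>w\<in>X. filterlim (\<lambda>(m, n). gromov_product d w (s m) (s n)) at_top
        (sequentially \<times>\<^sub>F sequentially))"

definition boundary_rel :: "'x set \<Rightarrow> ('x \<Rightarrow> 'x \<Rightarrow> real) \<Rightarrow> ((nat \<Rightarrow> 'x) \<times> (nat \<Rightarrow> 'x)) set" where
  "boundary_rel X d =
     {(s, t). converges_to_infinity X d s \<and> converges_to_infinity X d t \<and>
        (\<forall>w\<in>X. filterlim (\<lambda>(m, n). gromov_product d w (s m) (t n)) at_top
           (sequentially \<times>\<^sub>F sequentially))}"

definition isometric_action ::
  "('g, 'm) monoid_scheme \<Rightarrow> 'x set \<Rightarrow> ('x \<Rightarrow> 'x \<Rightarrow> real) \<Rightarrow> ('g \<Rightarrow> 'x \<Rightarrow> 'x) \<Rightarrow> bool" where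
  "isometric_action G X d \<rho> \<longleftrightarrow>
     group_action G X \<rho> \<and>
     (\<forall>g\<in>carrier G. \<forall>x\<in>X. \<forall>y\<in>X. d (\<rho> g x) (\<rho> g y) = d x y)"

definition limit_set ::
  "('g, 'm) monoid_scheme \<Rightarrow> 'x set \<Rightarrow> ('x \<Rightarrow> 'x \<Rightarrow> real) \<Rightarrow> ('g \<Rightarrow> 'x \<Rightarrow> 'x)
     \<Rightarrow> (nat \<Rightarrow> 'x) set set" where
  "limit_set G X d \<rho> =
     {boundary_rel X d `` {s} | s.
        converges_to_infinity X d s \<and> (\<exists>x\<in>X. range s \<subseteq> orbit G \<rho> x)}"

definition elementary_action ::
  "('g, 'm) monoid_scheme \<Rightarrow> 'x set \<Rightarrow> ('x \<Rightarrow> 'x \<Rightarrow> real) \<Rightarrow> ('g \<Rightarrow> 'x \<Rightarrow> 'x) \<Rightarrow> bool" where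
  "elementary_action G X d \<rho> \<longleftrightarrow>
     finite (limit_set G X d \<rho>) \<and> card (limit_set G X d \<rho>) \<le> 2"

definition acylindrical_action ::
  "('g, 'm) monoid_scheme \<Rightarrow> 'x set \<Rightarrow> ('x \<Rightarrow> 'x \<Rightarrow> real) \<Rightarrow> ('g \<Rightarrow> 'x \<Rightarrow> 'x) \<Rightarrow> bool" where
  "acylindrical_action G X d \<rho> \<longleftrightarrow>
     (\<forall>\<epsilon>>0. \<exists>R>0. \<exists>N::nat. \<forall>x\<in>X. \<forall>y\<in>X. d x y \<ge> R \<longrightarrow>
        finite {g \<in> carrier G. d x (\<rho> g x) \<le> \<epsilon> \<and> d y (\<rho> g y) \<le> \<epsilon>} \<and>
        card {g \<in> carrier G. d x (\<rho> g x) \<le> \<epsilon> \<and> d y (\<rho> g y) \<le> \<epsilon>} \<le> N)"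

text \<open>
  HOL cannot quantify existentially over types, so the type containing the points of the space
  is a parameter.  As a hypothesis of a theorem, with \<open>'x\<close> a free type variable, the predicate
  allows spaces over an arbitrary type.
\<close>

definition acylindrically_hyperbolic :: "'x itself \<Rightarrow> ('g, 'm) monoid_scheme \<Rightarrow> bool" where
  "acylindrically_hyperbolic T G \<longleftrightarrow>
     (\<exists>(X::'x set) d \<rho>. gromov_hyperbolic X d \<and> isometric_action G X d \<rho> \<and>
        acylindrical_action G X d \<rho> \<and> \<not> elementary_action G X d \<rho>)"

text \<open>
  A maximal finite normal subgroup need not exist in general, hence a predicate rather than a
  function of \<open>G\<close>.
\<close>

definition is_finite_radical :: "('g, 'm) monoid_scheme \<Rightarrow> 'g set \<Rightarrow> bool" where
  "is_finite_radical G R \<longleftrightarrow>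
     R \<lhd> G \<and> finite R \<and> (\<forall>N. N \<lhd> G \<and> finite N \<longrightarrow> N \<subseteq> R)"


section \<open>Powers states and the PHP property\<close>

definition powers_state ::
  "('g, 'm) monoid_scheme \<Rightarrow> ('g \<Rightarrow> 'a \<Rightarrow> 'a) \<Rightarrow> ('a::unital_cstar_algebra \<Rightarrow> complex) \<Rightarrow> bool" where
  "powers_state G \<alpha> \<phi> \<longleftrightarrow>
     state \<phi> \<and>
     (\<forall>F \<epsilon>. finite F \<and> \<epsilon> > 0 \<longrightarrow>
        (\<exists>\<mu>. finite (set_pmf \<mu>) \<and> set_pmf \<mu> \<subseteq> carrier G \<and>
           (\<forall>a\<in>F. norm ((\<Sum>g\<in>set_pmf \<mu>. pmf \<mu> g *\<^sub>R \<alpha> g a) - \<phi> a *\<^sub>C 1) < \<epsilon>)))"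

text \<open>
  The family in the first clause is indexed by a disjoint sum: \<open>Inl (g, i)\<close> stands for the set
  \<open>g C\<^sub>i\<close> and \<open>Inr (h, j)\<close> for the set \<open>h t\<^sub>j\<^sup>-\<^sup>1 (G - D\<^sub>j)\<close>, so that sets with distinct indices have
  to be disjoint even if they coincide as sets.
\<close>

definition PHP_property ::
  "('g, 'm) monoid_scheme \<Rightarrow> ('g \<Rightarrow> 'a \<Rightarrow> 'a) \<Rightarrow> ('a::unital_cstar_algebra \<Rightarrow> complex) \<Rightarrow> bool" where
  "PHP_property G \<alpha> \<phi> \<longleftrightarrow>
     (\<forall>F\<^sub>A F\<^sub>G (N::nat) \<epsilon>. finite F\<^sub>A \<and> finite F\<^sub>G \<and> F\<^sub>G \<subseteq> carrier G \<and> \<epsilon> > 0 \<longrightarrow>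
       (\<exists>n\<ge>N. \<exists>(t :: nat \<Rightarrow> 'g) C D.
          (\<forall>i\<in>{1..n}. t i \<in> carrier G \<and> C i \<subseteq> D i \<and> D i \<subseteq> carrier G) \<and>
          disjoint_family_on
            (case_sum (\<lambda>(g, i). g <#\<^bsub>G\<^esub> C i)
               (\<lambda>(h, j). (h \<otimes>\<^bsub>G\<^esub> inv\<^bsub>G\<^esub> t j) <#\<^bsub>G\<^esub> (carrier G - D j)))
            ((F\<^sub>G \<times> {1..n}) <+> (F\<^sub>G \<times> {1..n})) \<and>
          (\<forall>g\<in>carrier G.
             real (card ({i\<in>{1..n}. g \<in> D i} \<union>
                         {j\<in>{1..n}. g \<in> inv\<^bsub>G\<^esub> t j <#\<^bsub>G\<^esub> (carrier G - C j)}))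
               \<le> \<epsilon> * sqrt (real n)) \<and>
          (\<forall>a\<in>F\<^sub>A. norm ((1 / (2 * real n)) *\<^sub>R
                      (\<Sum>i=1..n. \<alpha> (t i) a + inv_into UNIV (\<alpha> (t i)) a) - \<phi> a *\<^sub>C 1) < \<epsilon>)))"

end

theory Submission
  imports Defs
begin

text \<open>
  Write \<open>K\<close> for the kernel of \<open>\<alpha>\<close>.  An element \<open>t = s\<inverse> k u\<close> with \<open>k \<in> K\<close> acts on \<open>A\<close> in the same way as
  \<open>s\<inverse> u\<close>.  Hence \<open>s\<close> and \<open>u\<close> can be chosen for the averaging condition alone, and \<open>k\<close> afterwards for the
  disjointness conditions alone.

  For the averages, let \<open>\<mu>\<close> be a measure that moves the given finite set close to the values of \<open>\<phi>\<close>,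
  and use the convolution \<open>\<mu>\<inverse> * \<mu>\<close>: the factor \<open>\<mu>\<close> acts first and produces elements close to scalars,
  and the factor \<open>\<mu>\<inverse>\<close> averages over automorphisms, which fix scalars and do not increase norms
  (\<open>star_automorphism_norm_le\<close>).  This measure is symmetric, so it handles the inverses \<open>t\<inverse>\<close> as well.
  Replacing \<open>\<mu>\<close> by a uniform measure on a finite list turns the convolution into an average over all
  pairs from that list (\<open>powers_state_symmetric_average\<close>).

  For the disjointness one can take \<open>C\<^sub>i = D\<^sub>i\<close>.  It suffices to find, for each finite set \<open>F\<close> of
  non-trivial elements of the group, one \<open>k \<in> K\<close> and disjoint sets \<open>A\<close>, \<open>B\<close> of group elements such that
  \<open>k\<close> maps the complement of \<open>B\<close> into \<open>A\<close> and no \<open>f \<in> F\<close> maps a point of \<open>A \<union> B\<close> into \<open>A \<union> B\<close>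
  (\<open>normal_subgroup_ping_pong\<close>).  Conjugates of \<open>k\<close> by elements that \<open>F\<close> keeps apart then provide all
  the \<open>k\<^sub>i\<close> (\<open>ping_pong_families\<close>), and every group element lies in at most two of the sets to be
  counted, while \<open>\<epsilon> \<surd>n\<close> is large.

  The sets \<open>A\<close> and \<open>B\<close> are shadows: pull the metric of the hyperbolic space back to the group along an
  orbit, write \<open>\<bar>g\<bar>\<close> for the displacement of the base point, and let \<open>A\<close> (and \<open>B\<close>) consist of the
  elements whose Gromov product with \<open>k\<close> (with \<open>k\<inverse>\<close>) is at least \<open>\<bar>k\<bar> / 2\<close>.  The elementary identity
  \<open>(uv|u) = \<bar>u\<bar> - (v|u\<inverse>)\<close> shows that \<open>k\<close> maps the complement of \<open>B\<close> into \<open>A\<close>, and the remaining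
  requirements become upper bounds for the Gromov products of \<open>k\<close>, \<open>k\<inverse>\<close>, \<open>f k\<close> and \<open>f k\<inverse>\<close>.  Such a
  \<open>k\<close> is found as follows.

  \<^item> The action being non-elementary, there are three sequences that diverge from each other; translating
    them yields any finite number of such sequences (\<open>ends_Suc\<close>), and so sequences that stay away from
    a prescribed number of points, with a uniform bound (\<open>avoiding_sequence\<close>).
  \<^item> The elements of bounded displacement form a finite normal subgroup, which is trivial by
    hypothesis.  It follows that finitely many non-trivial elements can be conjugated simultaneously to
    long ones (\<open>exists_far_displaced\<close>).
  \<^item> The group has no fixed point at infinity: otherwise all commutators would move points near the fixed
    point by a bounded amount, so by acylindricity all conjugacy classes would be finite and all
    displacements bounded (\<open>no_fixed_end\<close>).  This gives elements \<open>z\<close> for which both \<open>z\<close> and \<open>z\<inverse>\<close> point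
    away from prescribed points (\<open>avoiding_both_ways\<close>).
  \<^item> Multiplying two suitable conjugates of a long element of \<open>K\<close> gives long elements \<open>b \<in> K\<close> whose two
    directions differ and avoid a prescribed point (\<open>normal_subgroup_loxodromic\<close>).  Finally
    \<open>k = a b a\<inverse>\<close>, where all \<open>f \<in> F\<close> move \<open>a\<close> very far and \<open>b\<close> is much longer than \<open>a\<close>.
\<close>

section \<open>Automorphisms of C*-algebras do not increase norms\<close>

lemma norm_star: "norm (star x) = norm (x :: 'a::unital_cstar_algebra)"
proof -
  have *: "norm y \<le> norm (star y)" for y :: 'a
  proof (cases "norm y = 0")
    case False
    have "norm y * norm y \<le> norm (star y) * norm y"
      using norm_mult_ineq[of "star y" y] by (simp add: cstar_identity power2_eq_square)
    then show ?thesis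
      using False by simp
  qed simp
  from *[of x] *[of "star x"] show ?thesis
    by (simp add: star_star)
qed

lemma star_scaleR: "star (r *\<^sub>R x) = r *\<^sub>R star (x :: 'a::unital_cstar_algebra)"
  using star_scaleC[of "complex_of_real r" x] by (simp add: scaleC_complex_of_real)

lemma bounded_linear_star: "bounded_linear (star :: 'a::unital_cstar_algebra \<Rightarrow> 'a)"
  by (rule bounded_linear_intro[where K = 1]) (simp_all add: star_add star_scaleR norm_star)

lemma star_one: "star 1 = (1 :: 'a::unital_cstar_algebra)"
  using star_mult[of "star 1" 1] by (simp add: star_star)

lemma star_power: "star (x ^ n) = star (x :: 'a::unital_cstar_algebra) ^ n"
  by (induction n) (simp_all add: star_one star_mult power_commutes)

lemma norm_gbinomial_half_summable:
  fixes h :: "'a::real_normed_algebra_1"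
  assumes "norm h < 1"
  shows "summable (\<lambda>n. norm ((1/2 gchoose n) *\<^sub>R h ^ n))"
proof -
  have "norm (norm h) < 1"
    using assms by simp
  then have "ereal (norm (norm h)) < conv_radius (\<lambda>n. (1/2 :: real) gchoose n)"
    by (simp add: conv_radius_gchoose)
  from abs_summable_in_conv_radius[OF this]
  have "summable (\<lambda>n. norm ((1/2 gchoose n) * norm h ^ n))" .
  then show ?thesis
    by (rule summable_comparison_test[rotated])
      (auto intro!: exI[of _ 0] mult_left_mono norm_power_ineq simp: abs_mult)
qed

text \<open>
  The root is the binomial series of \<open>(1 + h)\<^bsup>1/2\<^esup>\<close>; the convolution of its coefficients is the
  Vandermonde identity.  As a norm limit of real polynomials in \<open>h\<close> it is self-adjoint and commutes with
  everything that commutes with \<open>h\<close>.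
\<close>

lemma selfadjoint_root:
  fixes h :: "'a::unital_cstar_algebra"
  assumes h: "norm h < 1" "star h = h"
  obtains y where "y * y = 1 + h" "star y = y" "\<And>w. w * h = h * w \<Longrightarrow> w * y = y * w"
proof -
  define f where "f n = (1/2 gchoose n) *\<^sub>R h ^ n" for n
  have f: "summable (\<lambda>n. norm (f n))"
    using norm_gbinomial_half_summable[OF h(1)] by (simp add: f_def)
  define y where "y = suminf f"
  have "(\<lambda>k. \<Sum>i\<le>k. f i * f (k - i)) sums (y * y)"
    unfolding y_def by (rule Cauchy_product_sums[OF f f])
  moreover have "(\<Sum>i\<le>k. f i * f (k - i)) = (1 gchoose k) *\<^sub>R h ^ k" for k
  proof -
    have "(\<Sum>i\<le>k. f i * f (k - i)) = (\<Sum>i\<le>k. ((1/2 gchoose i) * (1/2 gchoose (k - i))) *\<^sub>R h ^ k)"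
      by (rule sum.cong) (auto simp: f_def power_add[symmetric])
    also have "\<dots> = (\<Sum>i\<le>k. (1/2 gchoose i) * (1/2 gchoose (k - i))) *\<^sub>R h ^ k"
      by (simp add: scaleR_left.sum)
    also have "(\<Sum>i\<le>k. (1/2 gchoose i) * (1/2 gchoose (k - i))) = (1 gchoose k :: real)"
      using gbinomial_Vandermonde[of "1/2 :: real" "1/2" k] by (simp add: atMost_atLeast0)
    finally show ?thesis .
  qed
  ultimately have "(\<lambda>k. (1 gchoose k :: real) *\<^sub>R h ^ k) sums (y * y)"
    by simp
  moreover have "(\<lambda>k. (1 gchoose k :: real) *\<^sub>R h ^ k) sums (\<Sum>k\<in>{0, 1}. (1 gchoose k :: real) *\<^sub>R h ^ k)"
  proof (rule sums_finite)
    fix k :: nat assume "k \<notin> {0, 1}"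
    then have "(1 :: nat) choose k = 0"
      by (intro binomial_eq_0) auto
    then have "(1 gchoose k :: real) = 0"
      by (metis binomial_gbinomial of_nat_0 of_nat_1)
    then show "(1 gchoose k :: real) *\<^sub>R h ^ k = 0"
      by simp
  qed auto
  ultimately have "y * y = 1 + h"
    by (auto dest: sums_unique2)
  moreover have "star y = y"
    unfolding y_def bounded_linear.suminf[OF bounded_linear_star summable_norm_cancel[OF f]]
    by (intro suminf_cong) (simp add: f_def star_scaleR star_power h(2))
  moreover have "w * y = y * w" if "w * h = h * w" for w
    unfolding y_def suminf_mult2[OF summable_norm_cancel[OF f]]
      suminf_mult[OF summable_norm_cancel[OF f], symmetric]
    by (intro suminf_cong) (simp add: f_def power_commuting_commutes[OF that[symmetric]])
  ultimately show thesis
    using that by blast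
qed

text \<open>
  The element \<open>b + \<i> z\<close> is unitary, so it has norm one by the C*-identity, and \<open>b\<close> is its real part.
\<close>

lemma unitary_extension_norm:
  fixes b z :: "'a::unital_cstar_algebra"
  assumes "star b = b" "star z = z" "b * b + z * z = 1" "b * z = z * b"
  shows "norm b \<le> 1"
proof -
  interpret vs: vector_space "scaleC :: complex \<Rightarrow> 'a \<Rightarrow> 'a"
    by (rule vector_space_scaleC)
  define u where "u = b + \<i> *\<^sub>C z"
  have su: "star u = b + (- \<i>) *\<^sub>C z"
    by (simp add: u_def star_add star_scaleC assms)
  have "star u * u = b * b + \<i> *\<^sub>C (b * z) + ((- \<i>) *\<^sub>C (z * b) + (\<i> * - \<i>) *\<^sub>C (z * z))"
    unfolding su unfolding u_def
    by (simp only: distrib_left distrib_right mult_scaleC_left mult_scaleC_right scaleC_scaleC scaleC_add_right add_ac)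
  also have "\<dots> = b * b + z * z"
    by (simp add: assms(4))
  finally have "star u * u = b * b + z * z" .
  then have "(norm u)\<^sup>2 = 1"
    using cstar_identity[of u] assms(3) by simp
  then have u: "norm u = 1"
    using norm_ge_zero[of u] by (auto simp: power2_eq_1_iff simp del: norm_ge_zero)
  have "2 *\<^sub>R b = u + star u"
    unfolding su unfolding u_def by (simp add: scaleR_2)
  then have "2 * norm b \<le> norm u + norm (star u)"
    by (metis norm_scaleR norm_triangle_ineq abs_numeral)
  then show ?thesis
    by (simp add: norm_star u)
qed

lemma star_automorphismD:
  assumes "star_automorphism f"
  shows "f (x + y) = f x + f y" "f (c *\<^sub>C x) = c *\<^sub>C f x" "f (x * y) = f x * f y"
    "f (star x) = star (f x)" "f (r *\<^sub>R x) = r *\<^sub>R f x" "f (x - y) = f x - f y"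
    "f 1 = 1"
proof -
  have l: "Vector_Spaces.linear scaleC scaleC f" and b: "bij f"
    and m: "\<And>x y. f (x * y) = f x * f y" and s: "\<And>x. f (star x) = star (f x)"
    using assms by (auto simp: star_automorphism_def)
  interpret Vector_Spaces.linear scaleC scaleC f
    by (rule l)
  show "f (x + y) = f x + f y" "f (c *\<^sub>C x) = c *\<^sub>C f x" "f (x * y) = f x * f y"
    "f (star x) = star (f x)" "f (x - y) = f x - f y"
    using m s by (simp_all add: add scale diff)
  show "f (r *\<^sub>R x) = r *\<^sub>R f x"
    using scale[of "complex_of_real r" x] by (simp add: scaleC_complex_of_real)
  obtain e where e: "f e = 1"
    using b by (metis bij_pointE)
  show "f 1 = 1"
    using m[of 1 e] e by simp
qed

text \<open>
  A self-adjoint \<open>y\<close> with \<open>norm y < 1\<close> is the real part of the unitary \<open>y + \<i> \<surd>(1 - y\<^sup>2)\<close>.  Automorphisms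
  preserve this algebraic description, so the image of \<open>y\<close> is again the real part of a unitary.  Scaling
  and the C*-identity extend the bound to arbitrary elements.
\<close>

lemma star_automorphism_norm_le:
  fixes x :: "'a::unital_cstar_algebra"
  assumes f: "star_automorphism f"
  shows "norm (f x) \<le> norm x"
proof -
  note F = star_automorphismD[OF f]
  have sa1: "norm (f y) \<le> 1" if y: "norm y < 1" "star y = y" for y
  proof -
    have "norm (- (y * y)) < 1"
      using norm_mult_ineq[of y y] y(1) by (smt (verit) mult_le_one norm_ge_zero norm_minus_cancel mult_less_cancel_right1)
    moreover have "star (- (y * y)) = - (y * y)"
      using star_scaleR[of "- 1" "y * y"] by (simp add: star_mult y(2))
    ultimately obtain z where z: "z * z = 1 + - (y * y)" "star z = z"
      "\<And>w. w * - (y * y) = - (y * y) * w \<Longrightarrow> w * z = z * w"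
      using selfadjoint_root by blast
    have "f y * f y + f z * f z = f (y * y + z * z)"
      by (simp add: F)
    also have "\<dots> = 1"
      by (simp add: z(1) F)
    finally have "f y * f y + f z * f z = 1" .
    moreover have "y * z = z * y"
      by (rule z(3)) (simp add: mult.assoc)
    then have "f y * f z = f z * f y"
      by (metis F(3))
    moreover have "star (f y) = f y" "star (f z) = f z"
      by (simp_all add: F(4)[symmetric] y(2) z(2))
    ultimately show ?thesis
      by (intro unitary_extension_norm[of "f y" "f z"])
  qed
  have sa: "norm (f y) \<le> norm y" if y: "star y = y" for y
  proof (rule field_le_epsilon)
    fix e :: real assume e: "0 < e"
    define r where "r = norm y + e"
    have r: "r > 0" "norm y < r"
      using e by (auto simp: r_def add_nonneg_pos)
    have "norm (f ((1 / r) *\<^sub>R y)) \<le> 1"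
      using r y by (intro sa1) (auto simp: star_scaleR)
    then have "norm (f y) \<le> r"
      using r by (simp add: F field_simps)
    then show "norm (f y) \<le> norm y + e"
      by (simp add: r_def)
  qed
  have "(norm (f x))\<^sup>2 = norm (f (star x * x))"
    by (simp add: F cstar_identity)
  also have "\<dots> \<le> norm (star x * x)"
    by (rule sa) (simp add: star_mult star_star)
  also have "\<dots> = (norm x)\<^sup>2"
    by (rule cstar_identity)
  finally show ?thesis
    by (rule power2_le_imp_le) simp
qed

section \<open>Identities and translations in groups\<close>

lemma (in group) inv_cancel:
  assumes "x \<in> carrier G" "y \<in> carrier G"
  shows "x \<otimes> (inv x \<otimes> y) = y" "inv x \<otimes> (x \<otimes> y) = y"
  using assms by (simp_all add: m_assoc[symmetric])

lemma (in group) conj_eq_one: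
  assumes "a \<in> carrier G" "g \<in> carrier G" "inv a \<otimes> g \<otimes> a = \<one>"
  shows "g = \<one>"
proof -
  have "g = a \<otimes> (inv a \<otimes> g \<otimes> a) \<otimes> inv a"
    using assms(1,2) by (simp add: m_assoc inv_cancel)
  then show ?thesis
    using assms(1) by (simp add: assms(3))
qed

lemma (in group) mem_l_coset_iff:
  assumes "g \<in> carrier G" "S \<subseteq> carrier G" "y \<in> carrier G"
  shows "y \<in> g <# S \<longleftrightarrow> inv g \<otimes> y \<in> S"
proof
  assume "y \<in> g <# S"
  then obtain x where "x \<in> S" "y = g \<otimes> x"
    by (auto simp: l_coset_def)
  moreover have "inv g \<otimes> (g \<otimes> x) = x"
    using assms \<open>x \<in> S\<close> by (simp add: m_assoc[symmetric] subsetD)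
  ultimately show "inv g \<otimes> y \<in> S"
    by simp
next
  assume "inv g \<otimes> y \<in> S"
  moreover have "y = g \<otimes> (inv g \<otimes> y)"
    using assms by (simp add: m_assoc[symmetric])
  ultimately show "y \<in> g <# S"
    by (auto simp: l_coset_def)
qed

text \<open>
  Each new translation only has to avoid finitely many elements.
\<close>

lemma (in group) separating_translations:
  assumes inf: "infinite (carrier G)" and E: "finite E" "E \<subseteq> carrier G"
  shows "\<exists>w. (\<forall>i. w i \<in> carrier G) \<and>
    (\<forall>i\<in>{1..n::nat}. \<forall>j\<in>{1..n}. i \<noteq> j \<longrightarrow> (\<forall>e\<in>E. \<forall>e'\<in>E. e \<otimes> w i \<noteq> e' \<otimes> w j))"
proof (induction n)
  case 0
  show ?case
    by (intro exI[of _ "\<lambda>_. \<one>"]) auto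
next
  case (Suc n)
  then obtain w where w: "\<And>i. w i \<in> carrier G"
    "\<And>i j e e'. \<lbrakk>i \<in> {1..n}; j \<in> {1..n}; i \<noteq> j; e \<in> E; e' \<in> E\<rbrakk> \<Longrightarrow> e \<otimes> w i \<noteq> e' \<otimes> w j"
    by blast
  define bad where "bad = (\<lambda>(e, e', i). inv e \<otimes> (e' \<otimes> w i)) ` (E \<times> E \<times> {1..n})"
  have "finite bad"
    using E by (simp add: bad_def)
  then obtain u where u: "u \<in> carrier G" "u \<notin> bad"
    using inf by (meson finite_subset subsetI)
  have new: "e \<otimes> u \<noteq> e' \<otimes> w i" if "e \<in> E" "e' \<in> E" "i \<in> {1..n}" for e e' i
  proof
    assume "e \<otimes> u = e' \<otimes> w i"
    moreover have "e \<in> carrier G" "e' \<in> carrier G"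
      using E that by auto
    ultimately have "u = inv e \<otimes> (e' \<otimes> w i)"
      using u(1) w(1) by (simp add: inv_solve_left)
    moreover have "inv e \<otimes> (e' \<otimes> w i) \<in> bad"
      unfolding bad_def using that by (intro image_eqI[of _ _ "(e, e', i)"]) auto
    ultimately show False
      using u(2) by simp
  qed
  have "e \<otimes> (w(Suc n := u)) i \<noteq> e' \<otimes> (w(Suc n := u)) j"
    if "i \<in> {1..Suc n}" "j \<in> {1..Suc n}" "i \<noteq> j" "e \<in> E" "e' \<in> E" for i j e e'
    using that w(2)[of i j e e'] new[of e e' j] new[of e' e i] by (auto simp: le_Suc_eq)
  then show ?case
    using w(1) u(1) by (intro exI[of _ "w(Suc n := u)"]) auto
qed

section \<open>Gromov products of a left-invariant hyperbolic pseudometric\<close>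

text \<open>
  The geometry takes place on the group itself: \<open>D g h\<close> stands for the distance between the points \<open>g o\<close>
  and \<open>h o\<close> of an orbit.  Distinct elements may have distance zero.  By left-invariance the four-point
  condition at the identity implies it at each other base point.
\<close>

locale hyperbolic_group_metric = group G for G (structure) +
  fixes D :: "'a \<Rightarrow> 'a \<Rightarrow> real" and \<delta> :: real
  assumes D_self: "x \<in> carrier G \<Longrightarrow> D x x = 0"
    and D_sym: "\<lbrakk>x \<in> carrier G; y \<in> carrier G\<rbrakk> \<Longrightarrow> D x y = D y x"
    and D_triangle: "\<lbrakk>x \<in> carrier G; y \<in> carrier G; z \<in> carrier G\<rbrakk> \<Longrightarrow> D x z \<le> D x y + D y z"
    and D_left: "\<lbrakk>g \<in> carrier G; x \<in> carrier G; y \<in> carrier G\<rbrakk> \<Longrightarrow> D (g \<otimes> x) (g \<otimes> y) = D x y"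
    and delta_nonneg: "0 \<le> \<delta>"
    and four_point: "\<lbrakk>x \<in> carrier G; y \<in> carrier G; z \<in> carrier G\<rbrakk> \<Longrightarrow>
      gromov_product D \<one> x z \<ge> min (gromov_product D \<one> x y) (gromov_product D \<one> y z) - \<delta>"
begin

lemma D_conj:
  assumes "a \<in> carrier G" "g \<in> carrier G" "y \<in> carrier G"
  shows "D y (inv a \<otimes> g \<otimes> a \<otimes> y) = D (a \<otimes> y) (g \<otimes> (a \<otimes> y))"
  using D_left[of a y "inv a \<otimes> g \<otimes> a \<otimes> y"] assms by (simp add: m_assoc inv_cancel)

definition len :: "'a \<Rightarrow> real" where
  "len x = D \<one> x"

definition gp :: "'a \<Rightarrow> 'a \<Rightarrow> real" where
  "gp = gromov_product D \<one>"

lemma gp_eq: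
  "\<lbrakk>x \<in> carrier G; y \<in> carrier G\<rbrakk> \<Longrightarrow> gp x y = (len x + len y - D x y) / 2"
  by (simp add: gp_def gromov_product_def len_def D_sym[of _ \<one>])

lemma gp_sym: "\<lbrakk>x \<in> carrier G; y \<in> carrier G\<rbrakk> \<Longrightarrow> gp x y = gp y x"
  by (simp add: gp_eq D_sym[of x y])

lemma gp_le_len: "\<lbrakk>x \<in> carrier G; y \<in> carrier G\<rbrakk> \<Longrightarrow> gp x y \<le> len x"
  using D_triangle[of \<one> x y] by (simp add: gp_eq len_def)

lemma gp_le_len': "\<lbrakk>x \<in> carrier G; y \<in> carrier G\<rbrakk> \<Longrightarrow> gp x y \<le> len y"
  using gp_le_len gp_sym by metis

lemma gp_min:
  "\<lbrakk>x \<in> carrier G; y \<in> carrier G; z \<in> carrier G\<rbrakk> \<Longrightarrow> gp x z \<ge> min (gp x y) (gp y z) - \<delta>"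
  by (simp add: gp_def four_point)

text \<open>
  The form in which the four-point condition is used throughout: if \<open>y\<close> points in the direction of \<open>x\<close>,
  then it stays away from everything from which \<open>x\<close> stays away.
\<close>

lemma gp_propagate:
  assumes "x \<in> carrier G" "y \<in> carrier G" "z \<in> carrier G"
    and "gp x z \<le> c" "gp x y > c + \<delta>"
  shows "gp y z \<le> c + \<delta>"
  using gp_min[of x y z] assms by linarith

lemma len_nonneg: "x \<in> carrier G \<Longrightarrow> 0 \<le> len x"
  using D_triangle[of \<one> x \<one>] by (simp add: len_def D_self D_sym[of x \<one>])

lemma D_eq_len: "\<lbrakk>x \<in> carrier G; y \<in> carrier G\<rbrakk> \<Longrightarrow> D x y = len (inv x \<otimes> y)"
  using D_left[of "inv x" x y] by (simp add: len_def)

lemma D_mult_right: "\<lbrakk>x \<in> carrier G; y \<in> carrier G\<rbrakk> \<Longrightarrow> D x (x \<otimes> y) = len y"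
  using D_left[of x \<one> y] by (simp add: len_def)

lemma len_inv: "x \<in> carrier G \<Longrightarrow> len (inv x) = len x"
  using D_left[of x \<one> "inv x"] by (simp add: len_def D_sym[of x \<one>])

lemma len_mult_le: "\<lbrakk>x \<in> carrier G; y \<in> carrier G\<rbrakk> \<Longrightarrow> len (x \<otimes> y) \<le> len x + len y"
  using D_triangle[of \<one> x "x \<otimes> y"] by (simp add: len_def[of "x \<otimes> y"] len_def[of x] D_mult_right)

lemma len_mult_ge: "\<lbrakk>x \<in> carrier G; y \<in> carrier G\<rbrakk> \<Longrightarrow> len x - len y \<le> len (x \<otimes> y)"
  using len_mult_le[of "x \<otimes> y" "inv y"] by (simp add: m_assoc len_inv)

lemma len_mult_ge': "\<lbrakk>x \<in> carrier G; y \<in> carrier G\<rbrakk> \<Longrightarrow> len y - len x \<le> len (x \<otimes> y)"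
  using len_mult_le[of "inv x" "x \<otimes> y"] by (simp add: m_assoc[symmetric] len_inv)

text \<open>
  Seen from \<open>u\<close>, the points \<open>u v\<close> and \<open>\<one>\<close> look like \<open>v\<close> and \<open>inv u\<close> seen from \<open>\<one>\<close>.  So \<open>u v\<close> lies in the
  direction of \<open>u\<close> unless \<open>v\<close> cancels a large part of \<open>u\<close>.
\<close>

lemma gp_mult_left:
  assumes "u \<in> carrier G" "v \<in> carrier G"
  shows "gp (u \<otimes> v) u = len u - gp v (inv u)"
proof -
  have "D v (inv u) = len (u \<otimes> v)"
    using D_left[of u v "inv u"] assms by (simp add: len_def D_sym[of _ \<one>])
  moreover have "D (u \<otimes> v) u = len v"
    using assms by (simp add: D_sym[of _ u] D_mult_right)
  ultimately show ?thesis
    using assms by (simp add: gp_eq len_inv field_simps)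
qed

lemma gp_mult_self: "\<lbrakk>x \<in> carrier G; y \<in> carrier G\<rbrakk> \<Longrightarrow> len x - len y \<le> gp (x \<otimes> y) x"
  using gp_mult_left[of x y] gp_le_len[of y "inv x"] by simp

lemma gp_translate_le:
  assumes "g \<in> carrier G" "x \<in> carrier G" "y \<in> carrier G"
  shows "gp (g \<otimes> x) (g \<otimes> y) \<le> gp x y + len g"
  using assms len_mult_le[of g x] len_mult_le[of g y] by (simp add: gp_eq D_left field_simps)

lemma gp_translate_ge:
  assumes "g \<in> carrier G" "x \<in> carrier G" "y \<in> carrier G"
  shows "gp x y - len g \<le> gp (g \<otimes> x) (g \<otimes> y)"
  using assms len_mult_ge'[of g x] len_mult_ge'[of g y] by (simp add: gp_eq D_left field_simps)

lemma gp_mult_right_le: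
  assumes "x \<in> carrier G" "y \<in> carrier G" "z \<in> carrier G"
  shows "gp (x \<otimes> y) z \<le> gp x z + len y"
  using assms len_mult_le[of x y] D_triangle[of x "x \<otimes> y" z] by (simp add: gp_eq D_mult_right field_simps)

text \<open>
  If there is little cancellation in \<open>x y\<close> and in \<open>y v\<close>, and \<open>y\<close> is long, then there is little
  cancellation between \<open>x\<close> and \<open>y v\<close>, so the product starts in the direction of \<open>x\<close>.
\<close>

lemma gp_product_of_three:
  assumes "x \<in> carrier G" "y \<in> carrier G" "v \<in> carrier G"
    and "gp y (inv x) \<le> c" "gp v (inv y) \<le> c" "len y > 2 * c + \<delta>"
  shows "gp (x \<otimes> y \<otimes> v) x \<ge> len x - c - \<delta>"
proof -
  have "gp (y \<otimes> v) y > c + \<delta>"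
    using gp_mult_left[of y v] assms by simp
  then have "gp (y \<otimes> v) (inv x) \<le> c + \<delta>"
    using gp_propagate[of y "y \<otimes> v" "inv x" c] assms by (simp add: gp_sym[of y])
  then show ?thesis
    using gp_mult_left[of x "y \<otimes> v"] assms by (simp add: m_assoc)
qed

text \<open>
  Divergence from the base point and from each other stands in for convergence to \<open>m\<close> distinct points
  at infinity.
\<close>

definition ends :: "nat \<Rightarrow> real \<Rightarrow> (nat \<Rightarrow> nat \<Rightarrow> 'a) \<Rightarrow> bool" where
  "ends m c s \<longleftrightarrow>
     (\<forall>j<m. (\<forall>n. s j n \<in> carrier G) \<and> filterlim (\<lambda>n. len (s j n)) at_top sequentially) \<and>
     (\<forall>j<m. \<forall>l<m. j \<noteq> l \<longrightarrow> (\<forall>n k. gp (s j n) (s l k) \<le> c))"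

lemma endsD:
  assumes "ends m c s"
  shows "j < m \<Longrightarrow> s j n \<in> carrier G"
    and "j < m \<Longrightarrow> filterlim (\<lambda>n. len (s j n)) at_top sequentially"
    and "j < m \<Longrightarrow> l < m \<Longrightarrow> j \<noteq> l \<Longrightarrow> gp (s j n) (s l k) \<le> c"
  using assms by (auto simp: ends_def)

lemma ends_at_most_one:
  assumes "ends m c s" "p \<in> carrier G" "j < m" "l < m"
    and "gp (s j n) p > c + \<delta>" "gp (s l k) p > c + \<delta>"
  shows "j = l"
proof (rule ccontr)
  assume "j \<noteq> l"
  then have "gp (s j n) (s l k) \<le> c"
    using endsD(3)[OF assms(1)] assms by blast
  moreover have "s j n \<in> carrier G" "s l k \<in> carrier G"
    using endsD(1)[OF assms(1)] assms by auto
  ultimately show False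
    using gp_min[of "s j n" p "s l k"] assms gp_sym[of p "s l k"] by auto
qed

lemma at_top_obtain:
  fixes f :: "nat \<Rightarrow> real"
  assumes "filterlim f at_top sequentially"
  obtains N where "\<And>n. n \<ge> N \<Longrightarrow> f n > M"
  using assms by (auto simp: filterlim_at_top_dense eventually_sequentially)

text \<open>
  Let \<open>x\<close> be a far member of the first sequence.  Two of the given sequences stay away from \<open>inv x\<close>, and
  their translates by \<open>x\<close> point in the direction of \<open>x\<close>, hence away from the remaining sequences.
  Replacing the first sequence by these two translates increases the number by one.
\<close>

lemma ends_Suc:
  assumes E: "ends m c s" and m: "m \<ge> 3"
  shows "\<exists>c' s'. ends (Suc m) c' s'"
proof -
  obtain N where N: "\<And>n. n \<ge> N \<Longrightarrow> len (s 0 n) > 2 * c + 2 * \<delta>"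
    using at_top_obtain[OF endsD(2)[OF E, of 0]] m by auto
  define x where "x = s 0 N"
  have x: "x \<in> carrier G" "len x > 2 * c + 2 * \<delta>"
    using endsD(1)[OF E] m N by (auto simp: x_def)
  note S = endsD(1)[OF E]
  define bad where "bad j \<longleftrightarrow> (\<exists>n. gp (s j n) (inv x) > c + \<delta>)" for j
  have bad: "i = j" if "bad i" "bad j" "i < m" "j < m" for i j
    using ends_at_most_one[OF E, of "inv x" i j] that x by (auto simp: bad_def)
  have "\<exists>j<m. \<exists>l<m. j \<noteq> l \<and> \<not> bad j \<and> \<not> bad l"
  proof (cases "bad 0")
    case True
    then have "\<not> bad 1" "\<not> bad 2"
      using bad[of 0 1] bad[of 0 2] m by auto
    then show ?thesis
      using m by (intro exI[of _ 1] conjI exI[of _ 2]) auto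
  next
    case False
    show ?thesis
    proof (cases "bad 1")
      case True
      then have "\<not> bad 2"
        using bad[of 1 2] m by auto
      then show ?thesis
        using m False by (intro exI[of _ 0] conjI exI[of _ 2]) auto
    next
      case 1: False
      then show ?thesis
        using m False by (intro exI[of _ 0] conjI exI[of _ 1]) auto
    qed
  qed
  then obtain j l where jl: "j < m" "l < m" "j \<noteq> l" "\<not> bad j" "\<not> bad l"
    by blast
  have far: "gp (x \<otimes> s i n) (s i' k) \<le> c + \<delta>" if "\<not> bad i" "i < m" "i' < m" "i' \<noteq> 0" for i i' n k
  proof -
    have "gp (s i n) (inv x) \<le> c + \<delta>"
      using that(1) by (auto simp: bad_def not_less)
    then have "gp (x \<otimes> s i n) x \<ge> len x - c - \<delta>"
      using gp_mult_left[of x "s i n"] x S[of i n] that by simp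
    moreover have "gp x (s i' k) \<le> c"
      unfolding x_def using endsD(3)[OF E, of 0 i'] that m by auto
    ultimately show ?thesis
      using gp_propagate[of x "x \<otimes> s i n" "s i' k" c] x S that by (simp add: gp_sym[of x])
  qed
  have close: "gp (x \<otimes> s i n) (x \<otimes> s i' k) \<le> c + len x" if "i < m" "i' < m" "i \<noteq> i'" for i i' n k
    using gp_translate_le[of x "s i n" "s i' k"] endsD(3)[OF E that(1,2,3), of n k] x S that
    by fastforce
  define s' where "s' i = (if i = 0 then (\<lambda>n. x \<otimes> s j n) else if i = m then (\<lambda>n. x \<otimes> s l n) else s i)" for i
  have lim: "filterlim (\<lambda>n. len (x \<otimes> s i n)) at_top sequentially" if i: "i < m" for i
    unfolding filterlim_at_top_dense
  proof
    fix Z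
    obtain N where "\<And>n. n \<ge> N \<Longrightarrow> len (s i n) > Z + len x"
      using at_top_obtain[OF endsD(2)[OF E i], of "Z + len x"] by metis
    moreover have "len (s i n) - len x \<le> len (x \<otimes> s i n)" for n
      using len_mult_ge' x S i by blast
    ultimately have "\<And>n. n \<ge> N \<Longrightarrow> Z < len (x \<otimes> s i n)"
      by (smt (verit))
    then show "\<forall>\<^sub>F n in sequentially. Z < len (x \<otimes> s i n)"
      by (auto simp: eventually_sequentially)
  qed
  have bounds: "c + \<delta> \<le> c + len x + \<delta>" "c + len x \<le> c + len x + \<delta>" "c \<le> c + len x + \<delta>"
    using len_nonneg[OF x(1)] delta_nonneg by auto
  have "ends (Suc m) (c + len x + \<delta>) s'"
    unfolding ends_def
  proof (intro conjI allI impI)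
    fix i n assume "i < Suc m"
    then show "s' i n \<in> carrier G"
      using S x jl by (auto simp: s'_def)
  next
    fix i assume "i < Suc m"
    then show "filterlim (\<lambda>n. len (s' i n)) at_top sequentially"
      using lim jl endsD(2)[OF E] by (auto simp: s'_def)
  next
    fix i i' n k assume ii: "i < Suc m" "i' < Suc m" "i \<noteq> i'"
    have *: "gp (s' i n) (s' i' k) \<le> c + len x + \<delta>"
      if "i < Suc m" "i' < Suc m" "i < i'" for i i' n k
    proof (cases "i = 0")
      case True
      then show ?thesis
        using that jl far[of j i' n k] close[of j l n k] bounds m by (auto simp: s'_def)
    next
      case False
      then show ?thesis
        using that jl far[of l i k n] gp_sym[of "x \<otimes> s l k" "s i n"] S x endsD(3)[OF E, of i i' n k] bounds
        by (auto simp: s'_def)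
    qed
    have "s' i n \<in> carrier G" "s' i' k \<in> carrier G"
      using S x jl ii by (auto simp: s'_def)
    then show "gp (s' i n) (s' i' k) \<le> c + len x + \<delta>"
      using *[of i i' n k] *[of i' i k n] ii gp_sym by (metis nat_neq_iff)
  qed
  then show ?thesis
    by blast
qed

text \<open>
  If \<open>g\<close> moves three far points in different directions by a bounded amount, then \<open>\<one>\<close> and \<open>g\<close> are both
  approximate centres of the tripod spanned by these points, and so they are close to each other, with a
  bound that does not depend on \<open>R\<close>.
\<close>

lemma tripod:
  assumes g: "g \<in> carrier G" and x: "\<And>i. i < 3 \<Longrightarrow> x i \<in> carrier G"
    and c: "\<And>i j. \<lbrakk>i < (3::nat); j < 3; i \<noteq> j\<rbrakk> \<Longrightarrow> gp (x i) (x j) \<le> c"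
    and R: "\<And>i. i < 3 \<Longrightarrow> D (x i) (g \<otimes> x i) \<le> R"
    and far: "\<And>i. i < 3 \<Longrightarrow> len (x i) > R + c + 2 * \<delta>"
  shows "len g \<le> 2 * c + 4 * \<delta>"
proof -
  \<comment> \<open>the three points seen from \<open>g\<close>\<close>
  define y where "y i = inv g \<otimes> x i" for i
  have y: "y i \<in> carrier G" if "i < 3" for i
    using g x that by (simp add: y_def)
  have "gp (y i) (x i) \<ge> len (x i) - R" if "i < 3" for i
  proof -
    have "D (y i) (x i) \<le> R"
      using D_left[of g "y i" "x i"] R[OF that] g x[OF that] y[OF that]
      by (simp add: y_def m_assoc[symmetric])
    then show ?thesis
      using D_triangle[of \<one> "y i" "x i"] y[OF that] x[OF that] by (simp add: gp_eq len_def)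
  qed
  then have yx: "gp (y i) (x i) > c + 2 * \<delta>" if "i < 3" for i
    using far that by (smt (verit))
  have yy: "gp (y i) (y j) \<le> c + 2 * \<delta>" if "i < 3" "j < 3" "i \<noteq> j" for i j
  proof -
    have "gp (x i) (y i) > c + \<delta>"
      using yx[OF that(1)] gp_sym[OF y x] that delta_nonneg by (smt (verit))
    then have "gp (y i) (x j) \<le> c + \<delta>"
      using gp_propagate[of "x i" "y i" "x j" c] c that x y by blast
    moreover have "gp (x j) (y j) > c + \<delta> + \<delta>"
      using yx[OF that(2)] gp_sym[OF y x] that by (smt (verit))
    ultimately have "gp (y j) (y i) \<le> c + \<delta> + \<delta>"
      using gp_propagate[of "x j" "y j" "y i" "c + \<delta>"] gp_sym[of "x j" "y i"] that x y by fastforce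
    then show ?thesis
      using gp_sym[of "y i" "y j"] y that by auto
  qed
  \<comment> \<open>from either centre, at most one of the three points lies in the direction of the other centre; three points leave one that is good for both\<close>
  have bad1: "i = j" if "i < 3" "j < 3" "gp (x i) g > c + \<delta>" "gp (x j) g > c + \<delta>" for i j
    using c[of i j] gp_min[of "x i" g "x j"] gp_sym[of g "x j"] that x g by fastforce
  have bad2: "i = j" if "i < 3" "j < 3" "gp (y i) (inv g) > c + 3 * \<delta>" "gp (y j) (inv g) > c + 3 * \<delta>" for i j
    using yy[of i j] gp_min[of "y i" "inv g" "y j"] gp_sym[of "inv g" "y j"] that y g by fastforce
  have "\<exists>i<3. gp (x i) g \<le> c + \<delta> \<and> gp (y i) (inv g) \<le> c + 3 * \<delta>"
  proof (rule ccontr)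
    assume "\<not> ?thesis"
    then have "gp (x i) g > c + \<delta> \<or> gp (y i) (inv g) > c + 3 * \<delta>" if "i < 3" for i
      using that by force
    from this[of 0] this[of 1] this[of 2] show False
      using bad1[of 0 1] bad1[of 0 2] bad1[of 1 2] bad2[of 0 1] bad2[of 0 2] bad2[of 1 2] by auto
  qed
  then obtain i where i: "i < 3" "gp (x i) g \<le> c + \<delta>" "gp (y i) (inv g) \<le> c + 3 * \<delta>"
    by blast
  have "gp (g \<otimes> y i) g = len g - gp (y i) (inv g)"
    using gp_mult_left[OF g y[OF i(1)]] .
  moreover have "g \<otimes> y i = x i"
    using g x[OF i(1)] by (simp add: y_def m_assoc[symmetric])
  ultimately show ?thesis
    using i by simp
qed

end

section \<open>Displacement under an acylindrical action\<close>

text \<open>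
  \<open>three_ends\<close> is the trace of non-elementarity in the group, and \<open>no_finite_normal\<close> says that the finite
  radical is trivial.
\<close>

locale acylindrical_group_metric = hyperbolic_group_metric +
  assumes acylindrical: "\<epsilon> > 0 \<Longrightarrow> \<exists>R (N::nat). \<forall>x\<in>carrier G. \<forall>y\<in>carrier G. D x y \<ge> R \<longrightarrow>
        finite {g \<in> carrier G. D x (g \<otimes> x) \<le> \<epsilon> \<and> D y (g \<otimes> y) \<le> \<epsilon>} \<and>
        card {g \<in> carrier G. D x (g \<otimes> x) \<le> \<epsilon> \<and> D y (g \<otimes> y) \<le> \<epsilon>} \<le> N"
    and no_finite_normal: "\<lbrakk>N \<lhd> G; finite N\<rbrakk> \<Longrightarrow> N \<subseteq> {\<one>}"
    and three_ends: "\<exists>c s. ends 3 c s"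
begin

lemma ends_exist: "\<exists>c s. ends m c s"
proof -
  have "\<exists>c s. ends (3 + k) c s" for k
  proof (induction k)
    case 0
    then show ?case
      using three_ends by simp
  next
    case (Suc k)
    then show ?case
      using ends_Suc[of "3 + k"] by fastforce
  qed
  then obtain c s where "ends (3 + m) c s"
    by blast
  then have "ends m c s"
    by (auto simp: ends_def)
  then show ?thesis
    by blast
qed

text \<open>
  A point lies in the direction of at most one of \<open>m + 1\<close> divergent sequences, so \<open>m\<close> points leave at
  least one sequence untouched.  The bound \<open>c\<close> does not depend on the points.
\<close>

lemma avoiding_sequence:
  obtains c where "0 \<le> c"
    and "\<And>Q. \<lbrakk>Q \<subseteq> carrier G; finite Q; card Q \<le> m\<rbrakk> \<Longrightarrow>
      \<exists>x. (\<forall>n. x n \<in> carrier G) \<and> filterlim (\<lambda>n. len (x n)) at_top sequentially \<and>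
          (\<forall>n. \<forall>q\<in>Q. gp (x n) q \<le> c)"
proof -
  obtain c s where E: "ends (Suc m) c s"
    using ends_exist by blast
  show thesis
  proof (rule that[of "max 0 (c + \<delta>)"])
    fix Q assume Q: "Q \<subseteq> carrier G" "finite Q" "card Q \<le> m"
    have "\<exists>j<Suc m. \<forall>n. \<forall>q\<in>Q. gp (s j n) q \<le> c + \<delta>"
    proof (rule ccontr)
      assume "\<not> ?thesis"
      then have "\<forall>j\<in>{..<Suc m}. \<exists>q. q \<in> Q \<and> (\<exists>n. gp (s j n) q > c + \<delta>)"
        by (force simp: not_le)
      then obtain q where q: "\<forall>j\<in>{..<Suc m}. q j \<in> Q \<and> (\<exists>n. gp (s j n) (q j) > c + \<delta>)"
        by metis
      have "inj_on q {..<Suc m}"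
      proof (rule inj_onI)
        fix i j assume ij: "i \<in> {..<Suc m}" "j \<in> {..<Suc m}" "q i = q j"
        with q obtain n k where "gp (s i n) (q i) > c + \<delta>" "gp (s j k) (q i) > c + \<delta>"
          by metis
        moreover have "q i \<in> carrier G"
          using q ij Q by blast
        ultimately show "i = j"
          using ends_at_most_one[OF E] ij by auto
      qed
      moreover have "q ` {..<Suc m} \<subseteq> Q"
        using q by blast
      ultimately have "card {..<Suc m} \<le> card Q"
        using Q(2) card_inj_on_le by blast
      then show False
        using Q(3) by simp
    qed
    then obtain j where "j < Suc m" "\<forall>n. \<forall>q\<in>Q. gp (s j n) q \<le> c + \<delta>"
      by blast
    then show "\<exists>x. (\<forall>n. x n \<in> carrier G) \<and> filterlim (\<lambda>n. len (x n)) at_top sequentially \<and>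
          (\<forall>n. \<forall>q\<in>Q. gp (x n) q \<le> max 0 (c + \<delta>))"
      using endsD[OF E] by (intro exI[of _ "s j"]) (auto simp: le_max_iff_disj)
  qed simp
qed

lemma exists_long: "\<exists>x\<in>carrier G. len x > M"
proof -
  obtain c s where E: "ends 1 c s"
    using ends_exist by blast
  obtain N where "\<And>n. n \<ge> N \<Longrightarrow> len (s 0 n) > M"
    using at_top_obtain[OF endsD(2)[OF E]] by (metis less_one)
  then show ?thesis
    using endsD(1)[OF E, of 0] by auto
qed

lemma infinite_carrier: "infinite (carrier G)"
proof
  assume fin: "finite (carrier G)"
  obtain x where x: "x \<in> carrier G" "len x > Max (len ` carrier G)"
    using exists_long by blast
  have "len x \<le> Max (len ` carrier G)"
    using fin x(1) by (intro Max_ge) auto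
  then show False
    using x(2) by linarith
qed

lemma finite_displacing_two_points:
  "\<exists>y\<in>carrier G. finite {g \<in> carrier G. D \<one> (g \<otimes> \<one>) \<le> \<epsilon> \<and> D y (g \<otimes> y) \<le> \<epsilon>}"
proof -
  define e where "e = max 1 \<epsilon>"
  have "e > 0" "\<epsilon> \<le> e"
    by (auto simp: e_def)
  obtain R and N :: nat where R: "\<forall>x\<in>carrier G. \<forall>y\<in>carrier G. D x y \<ge> R \<longrightarrow>
        finite {g \<in> carrier G. D x (g \<otimes> x) \<le> e \<and> D y (g \<otimes> y) \<le> e} \<and>
        card {g \<in> carrier G. D x (g \<otimes> x) \<le> e \<and> D y (g \<otimes> y) \<le> e} \<le> N"
    using acylindrical[OF \<open>e > 0\<close>] by (elim exE)
  obtain y where y: "y \<in> carrier G" "len y > R"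
    using exists_long by blast
  then have "finite {g \<in> carrier G. D \<one> (g \<otimes> \<one>) \<le> e \<and> D y (g \<otimes> y) \<le> e}"
    using R[rule_format, of \<one> y] by (simp add: len_def)
  then have "finite {g \<in> carrier G. D \<one> (g \<otimes> \<one>) \<le> \<epsilon> \<and> D y (g \<otimes> y) \<le> \<epsilon>}"
    by (rule finite_subset[rotated]) (use \<open>\<epsilon> \<le> e\<close> in auto)
  then show ?thesis
    using y by blast
qed

text \<open>
  By \<open>tripod\<close>, applied to all conjugates, bounded displacement is automatically bounded by a universal
  constant.  So the elements of bounded displacement form a normal subgroup that acylindricity forces to
  be finite.
\<close>

lemma bounded_displacement_trivial:
  assumes f: "f \<in> carrier G" and R: "\<And>x. x \<in> carrier G \<Longrightarrow> D x (f \<otimes> x) \<le> R"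
  shows "f = \<one>"
proof -
  define N where "N = {g \<in> carrier G. \<exists>R. \<forall>x\<in>carrier G. D x (g \<otimes> x) \<le> R}"
  obtain c s where E: "ends 3 c s"
    using three_ends by blast
  note S = endsD(1)[OF E]
  define C where "C = 2 * c + 4 * \<delta>"
  have C: "D y (g \<otimes> y) \<le> C" if g: "g \<in> N" and y: "y \<in> carrier G" for g y
  proof -
    from g obtain R where gG: "g \<in> carrier G" and R: "\<And>x. x \<in> carrier G \<Longrightarrow> D x (g \<otimes> x) \<le> R"
      by (auto simp: N_def)
    have "\<exists>n. len (s i n) > R + c + 2 * \<delta>" if "i < 3" for i
      using at_top_obtain[OF endsD(2)[OF E that]] by (metis order_refl)
    then obtain n where n: "\<And>i. i < 3 \<Longrightarrow> len (s i (n i)) > R + c + 2 * \<delta>"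
      by metis
    define h where "h = inv y \<otimes> g \<otimes> y"
    have h: "h \<in> carrier G"
      using gG y by (simp add: h_def)
    have "len h \<le> 2 * c + 4 * \<delta>"
    proof (rule tripod[OF h, of "\<lambda>i. s i (n i)"])
      fix i :: nat assume i: "i < 3"
      have "D (s i (n i)) (h \<otimes> s i (n i)) = D (y \<otimes> s i (n i)) (g \<otimes> (y \<otimes> s i (n i)))"
        unfolding h_def using y gG S[OF i] by (rule D_conj)
      then show "D (s i (n i)) (h \<otimes> s i (n i)) \<le> R"
        using R[of "y \<otimes> s i (n i)"] y S[OF i] by simp
    qed (use S endsD(3)[OF E] n in auto)
    then show ?thesis
      using D_eq_len[of y "g \<otimes> y"] gG y by (simp add: C_def h_def m_assoc)
  qed
  have norm: "N \<lhd> G"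
    unfolding normal_inv_iff
  proof (intro conjI ballI subgroupI)
    show "N \<noteq> {}"
      using D_self by (auto simp: N_def intro!: exI[of _ \<one>] exI[of _ 0])
    show "N \<subseteq> carrier G"
      by (auto simp: N_def)
    show "inv a \<in> N" if "a \<in> N" for a
    proof -
      have a: "a \<in> carrier G" using that by (simp add: N_def)
      have "D x (inv a \<otimes> x) \<le> C" if x: "x \<in> carrier G" for x
        using C[OF \<open>a \<in> N\<close>, of "inv a \<otimes> x"] a x
        by (simp add: m_assoc[symmetric] D_sym[of x])
      then show ?thesis
        using a by (auto simp: N_def)
    qed
    show "a \<otimes> b \<in> N" if "a \<in> N" "b \<in> N" for a b
    proof -
      have ab: "a \<in> carrier G" "b \<in> carrier G" using that by (simp_all add: N_def)
      have "D x (a \<otimes> b \<otimes> x) \<le> C + C" if x: "x \<in> carrier G" for x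
        using C[OF \<open>b \<in> N\<close> x] C[OF \<open>a \<in> N\<close>, of "b \<otimes> x"] D_triangle[of x "b \<otimes> x" "a \<otimes> b \<otimes> x"] ab x
        by (simp add: m_assoc)
      then show ?thesis
        using ab by (auto simp: N_def)
    qed
    show "x \<otimes> h \<otimes> inv x \<in> N" if x: "x \<in> carrier G" and h: "h \<in> N" for x h
    proof -
      have hG: "h \<in> carrier G" using h by (simp add: N_def)
      have "D z (x \<otimes> h \<otimes> inv x \<otimes> z) \<le> C" if z: "z \<in> carrier G" for z
        using C[OF h, of "inv x \<otimes> z"] D_left[of x "inv x \<otimes> z" "h \<otimes> (inv x \<otimes> z)"] x z hG
        by (simp add: m_assoc[symmetric])
      then show ?thesis
        using x hG by (auto simp: N_def)
    qed
  qed
  have "finite N"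
  proof -
    obtain y where y: "y \<in> carrier G"
      "finite {g \<in> carrier G. D \<one> (g \<otimes> \<one>) \<le> C \<and> D y (g \<otimes> y) \<le> C}"
      using finite_displacing_two_points[of C] by blast
    moreover have "N \<subseteq> {g \<in> carrier G. D \<one> (g \<otimes> \<one>) \<le> C \<and> D y (g \<otimes> y) \<le> C}"
      using C y(1) by (auto simp: N_def)
    ultimately show ?thesis
      using finite_subset by blast
  qed
  then have "N \<subseteq> {\<one>}"
    using no_finite_normal norm by blast
  then show ?thesis
    using f R by (auto simp: N_def)
qed

text \<open>
  By induction on \<open>F\<close>.  If all elements of \<open>F\<close> are already displaced far at \<open>a\<close>, then walking from \<open>a\<close>
  in a direction \<open>b\<close> that avoids the finitely many directions \<open>inv a \<otimes> f \<otimes> a\<close> and their inverses makes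
  their displacement grow.  If \<open>f0\<close> were displaced boundedly along all such \<open>b\<close>, then take a sequence \<open>x\<close>
  that leaves to infinity in such a direction: each group element is eventually moved there by \<open>x n\<close>, and
  a recurring value of \<open>inv (x n) \<otimes> f0 \<otimes> x n\<close>, which exists by acylindricity, has bounded displacement
  everywhere and so is trivial.
\<close>

lemma exists_far_displaced:
  assumes "finite F" "F \<subseteq> carrier G - {\<one>}"
  shows "\<exists>a\<in>carrier G. \<forall>f\<in>F. D a (f \<otimes> a) > R"
  using assms
proof (induction F arbitrary: R rule: finite_induct)
  case empty
  then show ?case
    using one_closed by blast
next
  case (insert f0 F)
  have F: "f \<in> carrier G" "f \<noteq> \<one>" if "f \<in> insert f0 F" for f
    using insert.prems that by auto
  obtain c where c: "0 \<le> c" and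
    avoid: "\<And>Q. \<lbrakk>Q \<subseteq> carrier G; finite Q; card Q \<le> 2 * card F\<rbrakk> \<Longrightarrow>
      \<exists>x. (\<forall>n. x n \<in> carrier G) \<and> filterlim (\<lambda>n. len (x n)) at_top sequentially \<and>
          (\<forall>n. \<forall>q\<in>Q. gp (x n) q \<le> c)"
    using avoiding_sequence[of "2 * card F"] by metis
  define c' where "c' = c + \<delta>"
  obtain a where a: "a \<in> carrier G" and aF: "\<And>f. f \<in> F \<Longrightarrow> D a (f \<otimes> a) > 2 * c' + \<delta>"
    using insert.IH insert.prems by blast
  define conj where "conj f = inv a \<otimes> f \<otimes> a" for f
  have conj: "conj f \<in> carrier G" if "f \<in> insert f0 F" for f
    using F[OF that] a by (simp add: conj_def)
  have len_conj: "len (conj f) > 2 * c' + \<delta>" if "f \<in> F" for f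
    using aF[OF that] F[of f] that a by (simp add: D_eq_len conj_def m_assoc)
  define Q where "Q = conj ` F \<union> (\<lambda>f. inv (conj f)) ` F"
  have Q: "Q \<subseteq> carrier G" "finite Q"
    using conj insert.hyps by (auto simp: Q_def)
  have "card Q \<le> card (conj ` F) + card ((\<lambda>f. inv (conj f)) ` F)"
    unfolding Q_def by (rule card_Un_le)
  also have "\<dots> \<le> 2 * card F"
    using card_image_le[OF insert.hyps(1), of conj] card_image_le[OF insert.hyps(1), of "\<lambda>f. inv (conj f)"]
    by linarith
  finally obtain x where x: "\<And>n. x n \<in> carrier G" "filterlim (\<lambda>n. len (x n)) at_top sequentially"
      and xQ: "\<And>n q. q \<in> Q \<Longrightarrow> gp (x n) q \<le> c"
    using avoid[OF Q] by blast
  \<comment> \<open>the left translates \<open>x n \<otimes> y\<close> of a fixed \<open>y\<close> follow \<open>x n\<close> in an avoiding direction\<close>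
  have eventually_generic: "\<exists>n0. \<forall>n\<ge>n0. len (x n \<otimes> y) > B \<and> (\<forall>q\<in>Q. gp (x n \<otimes> y) q \<le> c')"
    if y: "y \<in> carrier G" for y B
  proof -
    obtain n0 where n0: "\<And>n. n \<ge> n0 \<Longrightarrow> len (x n) > max (B + len y) (c + \<delta> + len y)"
      using at_top_obtain[OF x(2)] by metis
    show ?thesis
    proof (intro exI[of _ n0] allI impI conjI ballI)
      fix n assume n: "n0 \<le> n"
      show "len (x n \<otimes> y) > B"
        using n0[OF n] len_mult_ge[OF x(1) y, of n] by simp
      fix q assume q: "q \<in> Q"
      have "gp (x n) (x n \<otimes> y) > c + \<delta>"
        using n0[OF n] gp_mult_self[OF x(1) y, of n] gp_sym[of "x n" "x n \<otimes> y"] x(1) y by simp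
      then show "gp (x n \<otimes> y) q \<le> c'"
        unfolding c'_def using gp_propagate[OF x(1) _ _ xQ[OF q]] x(1) y q Q by auto
    qed
  qed
  have moved: "D b (g \<otimes> b) \<ge> len b - 2 * c' - 2 * \<delta>"
    if g: "g \<in> carrier G" "len g > 2 * c' + \<delta>" and b: "b \<in> carrier G"
      and gen: "gp b g \<le> c'" "gp b (inv g) \<le> c'" for g b
  proof -
    have "gp (g \<otimes> b) g \<ge> len g - c'"
      using gp_mult_left[of g b] g b gen by simp
    then have 1: "gp g (g \<otimes> b) > c' + \<delta>"
      using g b by (simp add: gp_sym[of g])
    then have "gp (g \<otimes> b) b \<le> c' + \<delta>"
      using gp_propagate[of g "g \<otimes> b" b c'] g b gen by (simp add: gp_sym[of g b])
    moreover have "len (g \<otimes> b) \<ge> 0"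
      using len_nonneg g b by simp
    ultimately show ?thesis
      using g b by (simp add: gp_eq D_sym[of b])
  qed
  define g0 where "g0 = conj f0"
  have g0: "g0 \<in> carrier G"
    using conj by (simp add: g0_def)
  define B where "B = R + 2 * c' + 2 * \<delta>"
  have "\<exists>b\<in>carrier G. len b > B \<and> (\<forall>q\<in>Q. gp b q \<le> c') \<and> D b (g0 \<otimes> b) > R"
  proof (rule ccontr)
    assume "\<not> ?thesis"
    then have neg: "D b (g0 \<otimes> b) \<le> R" if "b \<in> carrier G" "len b > B" "\<forall>q\<in>Q. gp b q \<le> c'" for b
      using that by (meson not_less)
    define g where "g n = inv (x n) \<otimes> g0 \<otimes> x n" for n
    have gG: "g n \<in> carrier G" for n
      using x(1) g0 by (simp add: g_def)
    have gR: "\<exists>n0. \<forall>n\<ge>n0. D y (g n \<otimes> y) \<le> R" if y: "y \<in> carrier G" for y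
    proof -
      obtain n0 where n0: "\<forall>n\<ge>n0. len (x n \<otimes> y) > B \<and> (\<forall>q\<in>Q. gp (x n \<otimes> y) q \<le> c')"
        using eventually_generic[OF y] by blast
      have "D y (g n \<otimes> y) \<le> R" if n: "n \<ge> n0" for n
      proof -
        have "D y (g n \<otimes> y) = D (x n \<otimes> y) (g0 \<otimes> (x n \<otimes> y))"
          unfolding g_def using x(1) g0 y by (rule D_conj)
        then show ?thesis
          using neg[of "x n \<otimes> y"] n0 n x(1) y by simp
      qed
      then show ?thesis
        by blast
    qed
    obtain y0 where y0: "y0 \<in> carrier G"
      "finite {g \<in> carrier G. D \<one> (g \<otimes> \<one>) \<le> R \<and> D y0 (g \<otimes> y0) \<le> R}"
      using finite_displacing_two_points[of R] by blast
    define T where "T = {g \<in> carrier G. D \<one> (g \<otimes> \<one>) \<le> R \<and> D y0 (g \<otimes> y0) \<le> R}"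
    have T: "finite T"
      using y0(2) by (simp add: T_def)
    obtain n1 n2 where n12: "\<forall>n\<ge>n1. D \<one> (g n \<otimes> \<one>) \<le> R" "\<forall>n\<ge>n2. D y0 (g n \<otimes> y0) \<le> R"
      using gR[OF one_closed] gR[OF y0(1)] by blast
    have "g n \<in> T" if "n \<ge> max n1 n2" for n
      using n12 gG[of n] that by (auto simp: T_def)
    then have "g ` {max n1 n2..} \<subseteq> T"
      by auto
    then have "finite (g ` {max n1 n2..})"
      using T finite_subset by blast
    moreover have "infinite {max n1 n2..}"
      by (rule infinite_Ici)
    ultimately obtain m where m: "infinite {n \<in> {max n1 n2..}. g n = g m}"
      using pigeonhole_infinite[of "{max n1 n2..}" g] by blast
    have "g m = \<one>"
    proof (rule bounded_displacement_trivial[OF gG])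
      fix y assume "y \<in> carrier G"
      then obtain n0 where "\<forall>n\<ge>n0. D y (g n \<otimes> y) \<le> R"
        using gR by blast
      moreover obtain n where "n \<ge> n0" "g n = g m"
        using m by (metis (mono_tags, lifting) infinite_nat_iff_unbounded_le mem_Collect_eq)
      ultimately show "D y (g m \<otimes> y) \<le> R"
        by metis
    qed
    then have "g0 = \<one>"
      using conj_eq_one[OF x(1) g0] by (simp add: g_def)
    then have "f0 = \<one>"
      using conj_eq_one[OF a, of f0] F(1)[of f0] by (simp add: g0_def conj_def)
    then show False
      using F by blast
  qed
  then obtain b where b: "b \<in> carrier G" "len b > B" "\<forall>q\<in>Q. gp b q \<le> c'" "D b (g0 \<otimes> b) > R"
    by blast
  have eq: "D (a \<otimes> b) (f \<otimes> (a \<otimes> b)) = D b (conj f \<otimes> b)" if "f \<in> insert f0 F" for f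
    unfolding conj_def using D_conj[OF a F(1)[OF that] b(1)] by simp
  have "D b (conj f \<otimes> b) > R" if f: "f \<in> F" for f
    using moved[OF conj len_conj[OF f] b(1)] b f by (force simp: Q_def B_def)
  then have "D (a \<otimes> b) (f \<otimes> (a \<otimes> b)) > R" if "f \<in> insert f0 F" for f
    using that b(4) eq by (auto simp: g0_def)
  then show ?case
    using a b(1) by blast
qed

end

section \<open>Absence of a fixed point at infinity\<close>

context acylindrical_group_metric
begin

text \<open>
  The points \<open>inv (w n)\<close> converge to a point \<open>\<xi>\<close> at infinity which is fixed by the whole group, while the
  \<open>w n\<close> themselves stay away from \<open>\<xi>\<close>.  Put \<open>P n = inv (w n)\<close>.  Translating by \<open>inv (w n)\<close> the fact that
  \<open>w n\<close> is transverse to \<open>\<xi>\<close> shows that \<open>P n\<close>, and likewise each translate \<open>a \<otimes> P n\<close>, lies close to a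
  geodesic from the base point to \<open>\<xi>\<close>.  The changes \<open>len (a \<otimes> P n) - len (P n)\<close> define a Busemann
  quasi-morphism, so \<open>g \<otimes> h \<otimes> P n\<close> and \<open>h \<otimes> g \<otimes> P n\<close> have almost the same length and are close to each
  other.  Hence all commutators move \<open>P n\<close> by at most \<open>C\<close> once \<open>n\<close> is large.  Acylindricity bounds the
  number of such elements, so conjugacy classes are finite and all displacements are bounded.
\<close>

lemma no_fixed_end:
  assumes w: "\<And>n. w n \<in> carrier G" "filterlim (\<lambda>n. len (w n)) at_top sequentially"
    and transverse: "\<And>n k. k \<ge> k0 \<Longrightarrow> gp (w n) (inv (w k)) \<le> c"
    and fixed: "\<And>u B. u \<in> carrier G \<Longrightarrow> \<exists>n0. \<forall>n\<ge>n0. \<forall>k\<ge>n0. gp (u \<otimes> inv (w n)) (inv (w k)) > B"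
  shows False
proof -
  define P where "P n = inv (w n)" for n
  have P: "P n \<in> carrier G" for n
    using w(1) by (simp add: P_def)
  define C where "C = 2 * c + 10 * \<delta>"
  have commute: "\<exists>n0. \<forall>n\<ge>n0. D (g \<otimes> h \<otimes> P n) (h \<otimes> g \<otimes> P n) \<le> C"
    if g: "g \<in> carrier G" and h: "h \<in> carrier G" for g h
  proof -
    have branch: "\<exists>n0. \<forall>n\<ge>n0. \<exists>k0. \<forall>k\<ge>k0. gp (a \<otimes> P n) (P k) \<ge> len (a \<otimes> P n) - c - 2 * \<delta>"
      if a: "a \<in> carrier G" for a
    proof -
      obtain n0 where n0: "\<And>n. n \<ge> n0 \<Longrightarrow> len (w n) > c + \<delta> + len a"
        using at_top_obtain[OF w(2)] by metis
      have "\<exists>k1. \<forall>k\<ge>k1. gp (a \<otimes> P n) (P k) \<ge> len (a \<otimes> P n) - c - 2 * \<delta>" if n: "n \<ge> n0" for n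
      proof -
        define r where "r = w n \<otimes> inv a"
        have r: "r \<in> carrier G"
          using w(1) a by (simp add: r_def)
        obtain k1 where k1: "\<forall>n\<ge>k1. \<forall>k\<ge>k1. gp (r \<otimes> inv (w n)) (inv (w k)) > c + 2 * \<delta>"
          using fixed[OF r] by blast
        show ?thesis
        proof (intro exI[of _ "max k0 k1"] allI impI)
          fix k assume k: "k \<ge> max k0 k1"
          have "gp (w n) r > c + \<delta>"
            using gp_mult_self[OF w(1), of "inv a" n] n0[OF n] a len_inv[OF a] gp_sym[OF w(1) r, of n]
            by (simp add: r_def)
          then have "gp r (P k) \<le> c + \<delta>"
            using gp_propagate[OF w(1) r P, of n k c] transverse[of k n] k by (simp add: P_def)
          moreover have "gp (P k) (r \<otimes> P k) > c + \<delta> + \<delta>"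
            using k1[rule_format, of k k] k gp_sym[of "P k" "r \<otimes> P k"] P r by (simp add: P_def)
          ultimately have "gp (r \<otimes> P k) r \<le> c + 2 * \<delta>"
            using gp_propagate[of "P k" "r \<otimes> P k" r "c + \<delta>"] P r by (simp add: gp_sym[of r])
          moreover have ra: "inv (a \<otimes> P n) = r"
            using a w(1) by (simp add: r_def P_def inv_mult_group)
          then have "gp ((a \<otimes> P n) \<otimes> (r \<otimes> P k)) (a \<otimes> P n) = len (a \<otimes> P n) - gp (r \<otimes> P k) r"
            using gp_mult_left[of "a \<otimes> P n" "r \<otimes> P k"] a P r by simp
          moreover have "(a \<otimes> P n) \<otimes> (r \<otimes> P k) = P k"
            using inv_cancel[of "a \<otimes> P n" "P k"] a P by (simp add: ra)
          ultimately show "gp (a \<otimes> P n) (P k) \<ge> len (a \<otimes> P n) - c - 2 * \<delta>"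
            using gp_sym[of "a \<otimes> P n" "P k"] a P by simp
        qed
      qed
      then show ?thesis
        by blast
    qed
    have busemann: "\<exists>n0. \<forall>n\<ge>n0. \<bar>len (a \<otimes> b \<otimes> P n) - len (b \<otimes> P n) - (len (a \<otimes> P n) - len (P n))\<bar> \<le> 2 * \<delta>"
      if a: "a \<in> carrier G" and b: "b \<in> carrier G" for a b
    proof -
      obtain n0 where n0: "\<forall>n\<ge>n0. \<forall>k\<ge>n0. gp (b \<otimes> inv (w n)) (inv (w k)) > len a + \<delta>"
        using fixed[OF b] by blast
      have "\<bar>len (a \<otimes> b \<otimes> P n) - len (b \<otimes> P n) - (len (a \<otimes> P n) - len (P n))\<bar> \<le> 2 * \<delta>"
        if n: "n \<ge> n0" for n
      proof -
        have translate: "len (a \<otimes> y) = len a + len y - 2 * gp y (inv a)" if "y \<in> carrier G" for y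
          using D_left[of a y "inv a"] that a
          by (simp add: gp_eq len_inv len_def[of "a \<otimes> y"] D_sym[of "a \<otimes> y"] field_simps)
        have "gp (b \<otimes> P n) (P n) > len a + \<delta>"
          using n0 n by (auto simp: P_def)
        moreover have "gp (b \<otimes> P n) (inv a) \<le> len a" "gp (P n) (inv a) \<le> len a"
          using gp_le_len'[of _ "inv a"] a b P by (simp_all add: len_inv)
        ultimately have "\<bar>gp (b \<otimes> P n) (inv a) - gp (P n) (inv a)\<bar> \<le> \<delta>"
          using gp_min[of "b \<otimes> P n" "P n" "inv a"] gp_min[of "P n" "b \<otimes> P n" "inv a"]
            gp_sym[of "P n" "b \<otimes> P n"] a b P by (simp add: abs_le_iff min_def split: if_splits)
        then show ?thesis
          using translate[of "b \<otimes> P n"] translate[of "P n"] a b P by (simp add: m_assoc)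
      qed
      then show ?thesis
        by blast
    qed
    obtain n1 where n1: "\<forall>n\<ge>n1. \<exists>k0. \<forall>k\<ge>k0. gp (g \<otimes> h \<otimes> P n) (P k) \<ge> len (g \<otimes> h \<otimes> P n) - c - 2 * \<delta>"
      using branch[of "g \<otimes> h"] g h by auto
    obtain n2 where n2: "\<forall>n\<ge>n2. \<exists>k0. \<forall>k\<ge>k0. gp (h \<otimes> g \<otimes> P n) (P k) \<ge> len (h \<otimes> g \<otimes> P n) - c - 2 * \<delta>"
      using branch[of "h \<otimes> g"] g h by auto
    obtain n3 where n3: "\<forall>n\<ge>n3. \<bar>len (g \<otimes> h \<otimes> P n) - len (h \<otimes> P n) - (len (g \<otimes> P n) - len (P n))\<bar> \<le> 2 * \<delta>"
      using busemann[OF g h] by blast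
    obtain n4 where n4: "\<forall>n\<ge>n4. \<bar>len (h \<otimes> g \<otimes> P n) - len (g \<otimes> P n) - (len (h \<otimes> P n) - len (P n))\<bar> \<le> 2 * \<delta>"
      using busemann[OF h g] by blast
    have "D (g \<otimes> h \<otimes> P n) (h \<otimes> g \<otimes> P n) \<le> C" if n: "n \<ge> max (max n1 n2) (max n3 n4)" for n
    proof -
      define A B where "A = g \<otimes> h \<otimes> P n" and "B = h \<otimes> g \<otimes> P n"
      have AB: "A \<in> carrier G" "B \<in> carrier G"
        using g h P by (auto simp: A_def B_def)
      obtain k1 where k1: "\<forall>k\<ge>k1. gp A (P k) \<ge> len A - c - 2 * \<delta>"
        using n1[rule_format, of n] n unfolding A_def by auto
      obtain k2 where k2: "\<forall>k\<ge>k2. gp B (P k) \<ge> len B - c - 2 * \<delta>"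
        using n2[rule_format, of n] n unfolding B_def by auto
      define k where "k = max k1 k2"
      have "gp A (P k) \<ge> len A - c - 2 * \<delta>" "gp B (P k) \<ge> len B - c - 2 * \<delta>"
        using k1 k2 by (auto simp: k_def)
      then have "gp A B \<ge> min (len A) (len B) - c - 3 * \<delta>"
        using gp_min[of A "P k" B] gp_sym[of B "P k"] AB P[of k] by (simp add: min_def split: if_splits)
      moreover have "\<bar>len A - len B\<bar> \<le> 4 * \<delta>"
        using n3[rule_format, of n] n4[rule_format, of n] n by (simp add: A_def B_def)
      moreover have "D A B = len A + len B - 2 * gp A B"
        using AB by (simp add: gp_eq field_simps)
      ultimately show ?thesis
        by (simp add: C_def A_def[symmetric] B_def[symmetric] min_def abs_le_iff split: if_splits)
    qed
    then show ?thesis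
      by blast
  qed
  have "max 1 C > 0"
    by simp
  \<comment> \<open>the constant \<open>N\<close> bounds the number of conjugates of \<open>g\<close> because \<open>inv h \<otimes> g \<otimes> h \<otimes> inv g\<close> determines the conjugate\<close>
  from acylindrical[OF this] obtain R and N :: nat where R: "\<forall>x\<in>carrier G. \<forall>y\<in>carrier G. D x y \<ge> R \<longrightarrow>
        finite {g \<in> carrier G. D x (g \<otimes> x) \<le> max 1 C \<and> D y (g \<otimes> y) \<le> max 1 C} \<and>
        card {g \<in> carrier G. D x (g \<otimes> x) \<le> max 1 C \<and> D y (g \<otimes> y) \<le> max 1 C} \<le> N"
    by (elim exE)
  have conj_finite: "finite ((\<lambda>h. inv h \<otimes> g \<otimes> h) ` carrier G)" if g: "g \<in> carrier G" for g
  proof (rule ccontr)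
    assume "infinite ((\<lambda>h. inv h \<otimes> g \<otimes> h) ` carrier G)"
    then obtain T where T: "finite T" "card T = Suc N" "T \<subseteq> (\<lambda>h. inv h \<otimes> g \<otimes> h) ` carrier G"
      using infinite_arbitrarily_large by blast
    then obtain H where H: "H \<subseteq> carrier G" "finite H" "T = (\<lambda>h. inv h \<otimes> g \<otimes> h) ` H"
      using finite_subset_image[OF T(1,3)] by blast
    have "\<forall>h\<in>H. \<exists>n0. \<forall>n\<ge>n0. D (inv g \<otimes> h \<otimes> P n) (h \<otimes> inv g \<otimes> P n) \<le> C"
      using commute g H by blast
    then obtain n0 where n0: "\<forall>h\<in>H. \<forall>n\<ge>n0 h. D (inv g \<otimes> h \<otimes> P n) (h \<otimes> inv g \<otimes> P n) \<le> C"
      by metis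
    define n where "n = Max (insert 0 (n0 ` H))"
    have n: "n \<ge> n0 h" if "h \<in> H" for h
      using H(2) that by (auto simp: n_def)
    obtain n' where n': "\<And>m. m \<ge> n' \<Longrightarrow> len (w m) > R + len (w n)"
      using at_top_obtain[OF w(2)] by metis
    define k where "k = max n n'"
    have "D (P n) (P k) \<ge> R"
      using n'[of k] D_triangle[of \<one> "P n" "P k"] P len_inv[OF w(1)]
      by (simp add: k_def P_def len_def)
    define S where "S = {g \<in> carrier G. D (P n) (g \<otimes> P n) \<le> max 1 C \<and> D (P k) (g \<otimes> P k) \<le> max 1 C}"
    have S: "finite S" "card S \<le> N"
      using R P \<open>D (P n) (P k) \<ge> R\<close> unfolding S_def by blast+
    have "inv h \<otimes> g \<otimes> h \<otimes> inv g \<in> S" if h: "h \<in> H" for h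
    proof -
      have hG: "h \<in> carrier G"
        using H h by blast
      have "D (P m) (inv h \<otimes> g \<otimes> h \<otimes> inv g \<otimes> P m) \<le> C" if m: "m \<ge> n" for m
      proof -
        have "D (P m) (inv h \<otimes> g \<otimes> h \<otimes> inv g \<otimes> P m) =
            D (inv g \<otimes> h \<otimes> P m) (inv g \<otimes> h \<otimes> (inv h \<otimes> g \<otimes> h \<otimes> inv g \<otimes> P m))"
          using D_left[of "inv g \<otimes> h" "P m"] g hG P by simp
        also have "inv g \<otimes> h \<otimes> (inv h \<otimes> g \<otimes> h \<otimes> inv g \<otimes> P m) = h \<otimes> inv g \<otimes> P m"
          using g hG P by (simp add: m_assoc inv_cancel)
        finally show ?thesis
          using n0 n[OF h] m h by simp
      qed
      from this[of n] this[of k] show ?thesis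
        using g hG by (auto simp: S_def k_def)
    qed
    then have "(\<lambda>t. t \<otimes> inv g) ` T \<subseteq> S"
      using H(3) by auto
    moreover have "inj_on (\<lambda>t. t \<otimes> inv g) T"
    proof (rule inj_onI)
      fix x y assume xy: "x \<in> T" "y \<in> T" "x \<otimes> inv g = y \<otimes> inv g"
      moreover have "T \<subseteq> carrier G"
        using T(3) g by auto
      ultimately show "x = y"
        using g right_cancel[of "inv g" x y] by auto
    qed
    ultimately have "card T \<le> card S"
      using S(1) by (metis card_inj_on_le)
    then show False
      using T(2) S(2) by simp
  qed
  have trivial: "g = \<one>" if g: "g \<in> carrier G" for g
  proof (rule bounded_displacement_trivial[OF g])
    fix h assume h: "h \<in> carrier G"
    have "D h (g \<otimes> h) = len (inv h \<otimes> g \<otimes> h)"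
      using g h by (simp add: D_eq_len m_assoc)
    also have "\<dots> \<le> Max (len ` (\<lambda>h. inv h \<otimes> g \<otimes> h) ` carrier G)"
      using conj_finite[OF g] h by (intro Max_ge) auto
    finally show "D h (g \<otimes> h) \<le> Max (len ` (\<lambda>h. inv h \<otimes> g \<otimes> h) ` carrier G)" .
  qed
  have "carrier G \<subseteq> {\<one>}"
    using trivial by blast
  then show False
    using infinite_carrier finite_subset by blast
qed

text \<open>
  If the claim fails for \<open>c = k\<close>, then there are \<open>p k\<close> and \<open>q k\<close> such that each long \<open>z\<close> either points towards
  \<open>p k\<close> or has an inverse pointing towards \<open>q k\<close>.  At most one of three divergent sequences points towards
  \<open>p k\<close>, and it is the same one for infinitely many \<open>k\<close>.  The inverses of the other two sequences, \<open>a\<close>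
  and \<open>b\<close>, then all point towards \<open>q k\<close>, so they converge to a common point at infinity.  One of these two
  sequences is transverse to that point.  Right translation by a fixed element does not change the
  direction of a long \<open>z\<close>, so the same alternative applied to \<open>z \<otimes> inv u\<close> shows that \<open>u\<close> fixes the point.
  This is the situation excluded by \<open>no_fixed_end\<close>.
\<close>

lemma exists_avoiding_both_ways:
  "\<exists>c\<ge>0. \<forall>p\<in>carrier G. \<forall>q\<in>carrier G. \<forall>M.
     \<exists>z\<in>carrier G. len z > M \<and> gp z p \<le> c \<and> gp (inv z) q \<le> c"
proof (rule ccontr)
  assume neg: "\<not> ?thesis"
  have "\<exists>p q M. p \<in> carrier G \<and> q \<in> carrier G \<and>
      (\<forall>z\<in>carrier G. len z > M \<longrightarrow> gp z p \<le> real k \<longrightarrow> gp (inv z) q > real k)" for k :: nat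
    using neg of_nat_0_le_iff[of k] by (meson not_less)
  then obtain p q M where pq: "\<And>k. p k \<in> carrier G" "\<And>k. q k \<in> carrier G"
    and cover: "\<And>k z. \<lbrakk>z \<in> carrier G; len z > M k; gp z (p k) \<le> real k\<rbrakk> \<Longrightarrow> gp (inv z) (q k) > real k"
    by metis
  obtain c s where E: "ends 3 c s"
    using three_ends by blast
  note S = endsD(1)[OF E]
  have "\<exists>j<3. \<forall>i<3. i \<noteq> j \<longrightarrow> (\<forall>n. gp (s i n) (p k) \<le> c + \<delta>)" for k
  proof (cases "\<exists>j<3. \<exists>n. gp (s j n) (p k) > c + \<delta>")
    case True
    then obtain j n where j: "j < 3" "gp (s j n) (p k) > c + \<delta>"
      by blast
    have "gp (s i m) (p k) \<le> c + \<delta>" if "i < 3" "i \<noteq> j" for i m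
      using ends_at_most_one[OF E pq(1) that(1) j(1) _ j(2)] that(2) by (meson not_less)
    then show ?thesis
      using j by blast
  next
    case False
    then have "gp (s i n) (p k) \<le> c + \<delta>" if "i < 3" for i n
      using that by (meson not_less)
    then show ?thesis
      by (intro exI[of _ 0]) auto
  qed
  then obtain bad where bad: "\<And>k. bad k < 3"
    "\<And>k i n. \<lbrakk>i < 3; i \<noteq> bad k\<rbrakk> \<Longrightarrow> gp (s i n) (p k) \<le> c + \<delta>"
    by metis
  have "finite (range bad)"
    by (rule finite_subset[of _ "{..<3}"]) (use bad in auto)
  then obtain k0 where inf: "infinite {k. bad k = bad k0}"
    using pigeonhole_infinite[of UNIV bad] by auto
  define j where "j = bad k0"
  have large: "\<exists>k. real k \<ge> B \<and> bad k = j" for B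
  proof -
    obtain k where "k \<ge> nat \<lceil>B\<rceil>" "bad k = j"
      using inf unfolding infinite_nat_iff_unbounded_le j_def by blast
    then show ?thesis
      by (intro exI[of _ k]) linarith
  qed
  have attract: "gp (inv z) (q k) > real k"
    if "i < 3" "i \<noteq> j" "bad k = j" "real k \<ge> c + 2 * \<delta>" "z \<in> carrier G" "len z > M k"
      "gp (s i n) z > c + \<delta> + \<delta>" for i k z n
  proof -
    have "gp (s i n) (p k) \<le> c + \<delta>"
      using bad that by blast
    then have "gp z (p k) \<le> c + \<delta> + \<delta>"
      using gp_propagate[OF S _ pq(1), of i z n k "c + \<delta>"] that by blast
    then show ?thesis
      using cover that by auto
  qed
  define a b :: nat where "a = (if j = 0 then 1 else 0)" and "b = (if j = 0 \<or> j = 1 then 2 else 1)"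
  have ab: "a < 3" "b < 3" "a \<noteq> b" "a \<noteq> j" "b \<noteq> j"
    by (auto simp: a_def b_def)
  obtain k1 where k1: "real k1 \<ge> c + 4 * \<delta>" "bad k1 = j"
    using large by blast
  have self_attract: "\<exists>n0. \<forall>n\<ge>n0. gp (inv (s i n)) (q k) > real k"
    if i: "i < 3" "i \<noteq> j" and k: "bad k = j" "real k \<ge> c + 2 * \<delta>" for i k
  proof -
    obtain n0 where n0: "\<And>n. n \<ge> n0 \<Longrightarrow> len (s i n) > max (M k) (c + \<delta> + \<delta>)"
      using at_top_obtain[OF endsD(2)[OF E i(1)]] by metis
    have "gp (inv (s i n)) (q k) > real k" if n: "n \<ge> n0" for n
    proof (rule attract[OF i k])
      show "s i n \<in> carrier G" "len (s i n) > M k"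
        using S[OF i(1)] n0[OF n] by auto
      have "gp (s i n) (s i n) = len (s i n)"
        using S[OF i(1)] by (simp add: gp_eq D_self)
      then show "gp (s i n) (s i n) > c + \<delta> + \<delta>"
        using n0[OF n] by simp
    qed
    then show ?thesis
      by blast
  qed
  have k1': "real k1 \<ge> c + 2 * \<delta>"
    using k1 delta_nonneg by linarith
  obtain na where na: "gp (inv (s a na)) (q k1) > real k1"
    using self_attract[OF ab(1,4) k1(2) k1'] by blast
  define r where "r = inv (s a na)"
  have r: "r \<in> carrier G"
    using S ab by (simp add: r_def)
  have "\<exists>i. i < 3 \<and> i \<noteq> j \<and> (\<forall>n. gp (s i n) r \<le> c + \<delta>)"
    using ends_at_most_one[OF E r ab(1,2)] ab by (meson not_less)
  then obtain i where i: "i < 3" "i \<noteq> j" and ir: "\<And>n. gp (s i n) r \<le> c + \<delta>"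
    by blast
  obtain k2 where k2: "\<And>n. n \<ge> k2 \<Longrightarrow> gp (inv (s i n)) (q k1) > real k1"
    using self_attract[OF i k1(2) k1'] by blast
  show False
  proof (rule no_fixed_end[of "s i" k2 "c + 2 * \<delta>"])
    show "s i n \<in> carrier G" for n
      using S i by blast
    show "filterlim (\<lambda>n. len (s i n)) at_top sequentially"
      using endsD(2)[OF E i(1)] .
    show "gp (s i n) (inv (s i k)) \<le> c + 2 * \<delta>" if k: "k \<ge> k2" for n k
    proof -
      have "gp r (inv (s i k)) \<ge> min (gp r (q k1)) (gp (q k1) (inv (s i k))) - \<delta>"
        using gp_min r pq S i by simp
      then have "gp r (inv (s i k)) > c + 2 * \<delta>"
        using k2[OF k] na k1 delta_nonneg gp_sym[of "q k1" "inv (s i k)"] pq S[OF i(1)] by (simp add: r_def)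
      then have "gp (inv (s i k)) (s i n) \<le> c + \<delta> + \<delta>"
        using gp_propagate[of r "inv (s i k)" "s i n" "c + \<delta>"] ir[of n] gp_sym[of r "s i n"] r S[OF i(1)]
        by simp
      then show ?thesis
        using gp_sym[of "inv (s i k)" "s i n"] S[OF i(1)] by simp
    qed
    show "\<exists>n0. \<forall>n\<ge>n0. \<forall>k\<ge>n0. gp (u \<otimes> inv (s i n)) (inv (s i k)) > B" if u: "u \<in> carrier G" for u B
    proof -
      obtain k where k: "real k \<ge> max (B + \<delta>) (c + 2 * \<delta>)" "bad k = j"
        using large by blast
      then have k': "real k \<ge> c + 2 * \<delta>"
        by simp
      obtain n1 where n1: "\<forall>n\<ge>n1. gp (inv (s i n)) (q k) > real k"
        using self_attract[OF i k(2) k'] by blast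
      obtain n2 where n2: "\<And>n. n \<ge> n2 \<Longrightarrow> len (s i n) > max (M k) (c + 2 * \<delta>) + len u"
        using at_top_obtain[OF endsD(2)[OF E i(1)]] by metis
      have "gp (u \<otimes> inv (s i n)) (inv (s i l)) > B" if n: "n \<ge> max n1 n2" and l: "l \<ge> max n1 n2" for n l
      proof -
        define z where "z = s i n \<otimes> inv u"
        have z: "z \<in> carrier G"
          using S[OF i(1)] u by (simp add: z_def)
        have "gp (inv z) (q k) > real k"
        proof (rule attract[OF i k(2) k' z])
          show "len z > M k"
            using len_mult_ge[of "s i n" "inv u"] n2[of n] n S[OF i(1)] u by (simp add: z_def len_inv)
          show "gp (s i n) z > c + \<delta> + \<delta>"
            using gp_mult_self[of "s i n" "inv u"] n2[of n] n S[OF i(1)] u gp_sym[of "s i n" z] z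
            by (simp add: z_def len_inv)
        qed
        moreover have "inv z = u \<otimes> inv (s i n)"
          using S[OF i(1)] u by (simp add: z_def inv_mult_group)
        moreover have "gp (q k) (inv (s i l)) > real k"
          using n1 l gp_sym[of "q k" "inv (s i l)"] S[OF i(1)] pq by simp
        ultimately show ?thesis
          using gp_min[of "u \<otimes> inv (s i n)" "q k" "inv (s i l)"] S[OF i(1)] pq u k(1) by (simp add: min_def split: if_splits)
      qed
      then show ?thesis
        by blast
    qed
  qed
qed

text \<open>
  Sandwiching an element provided by \<open>exists_avoiding_both_ways\<close> as \<open>x \<otimes> y \<otimes> inv x'\<close> makes the product
  start in the direction of \<open>x\<close> and its inverse in the direction of \<open>x'\<close>; these two can be chosen to avoid
  any number of points.
\<close>

lemma avoiding_both_ways: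
  obtains c where "0 \<le> c"
    and "\<And>Q Q' M. \<lbrakk>Q \<subseteq> carrier G; finite Q; card Q \<le> m; Q' \<subseteq> carrier G; finite Q'; card Q' \<le> m\<rbrakk> \<Longrightarrow>
      \<exists>z\<in>carrier G. len z > M \<and> (\<forall>q\<in>Q. gp z q \<le> c) \<and> (\<forall>q\<in>Q'. gp (inv z) q \<le> c)"
proof -
  obtain c1 where c1: "0 \<le> c1" and both: "\<And>p q M. \<lbrakk>p \<in> carrier G; q \<in> carrier G\<rbrakk> \<Longrightarrow>
     \<exists>z\<in>carrier G. len z > M \<and> gp z p \<le> c1 \<and> gp (inv z) q \<le> c1"
    using exists_avoiding_both_ways by blast
  obtain c2 where c2: "0 \<le> c2" and avoid: "\<And>Q. \<lbrakk>Q \<subseteq> carrier G; finite Q; card Q \<le> m\<rbrakk> \<Longrightarrow>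
      \<exists>x. (\<forall>n. x n \<in> carrier G) \<and> filterlim (\<lambda>n. len (x n)) at_top sequentially \<and>
          (\<forall>n. \<forall>q\<in>Q. gp (x n) q \<le> c2)"
    using avoiding_sequence[of m] by metis
  have avoid': "\<exists>x\<in>carrier G. len x > M \<and> (\<forall>q\<in>Q. gp x q \<le> c2)"
    if Q: "Q \<subseteq> carrier G" "finite Q" "card Q \<le> m" for Q M
  proof -
    obtain x where x: "\<And>n. x n \<in> carrier G" "filterlim (\<lambda>n. len (x n)) at_top sequentially"
      "\<And>n. \<forall>q\<in>Q. gp (x n) q \<le> c2"
      using avoid[OF Q] by blast
    obtain n where "len (x n) > M"
      using at_top_obtain[OF x(2)] by (metis order_refl)
    then show ?thesis
      using x by blast
  qed
  show thesis
  proof (rule that[of "c2 + \<delta>"])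
    show "0 \<le> c2 + \<delta>"
      using c2 delta_nonneg by simp
    fix Q Q' M
    assume Q: "Q \<subseteq> carrier G" "finite Q" "card Q \<le> m" and Q': "Q' \<subseteq> carrier G" "finite Q'" "card Q' \<le> m"
    define M' where "M' = max M (c2 + \<delta>) + c1 + \<delta>"
    obtain x where x: "x \<in> carrier G" "len x > M'" "\<forall>q\<in>Q. gp x q \<le> c2"
      using avoid'[OF Q] by blast
    obtain x' where x': "x' \<in> carrier G" "len x' > M'" "\<forall>q\<in>Q'. gp x' q \<le> c2"
      using avoid'[OF Q'] by blast
    obtain y where y: "y \<in> carrier G" "len y > 2 * c1 + \<delta>" "gp y (inv x) \<le> c1" "gp (inv y) (inv x') \<le> c1"
      using both[of "inv x" "inv x'"] x(1) x'(1) by blast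
    define z where "z = x \<otimes> y \<otimes> inv x'"
    have z: "z \<in> carrier G"
      using x x' y by (simp add: z_def)
    have inv_z: "inv z = x' \<otimes> inv y \<otimes> inv x"
      using x x' y by (simp add: z_def inv_mult_group m_assoc)
    have zx: "gp z x \<ge> len x - c1 - \<delta>"
      unfolding z_def using x x' y gp_sym[of "inv x'" "inv y"]
      by (intro gp_product_of_three) auto
    have zx': "gp (inv z) x' \<ge> len x' - c1 - \<delta>"
      unfolding inv_z using x x' y gp_sym[of "inv x" y]
      by (intro gp_product_of_three) (auto simp: len_inv)
    have "len z > M"
      using zx gp_le_len[OF z x(1)] x(2) by (simp add: M'_def)
    moreover have "gp z q \<le> c2 + \<delta>" if "q \<in> Q" for q
      using gp_propagate[of x z q c2] gp_sym[of x z] zx x z that Q by (auto simp: M'_def)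
    moreover have "gp (inv z) q \<le> c2 + \<delta>" if "q \<in> Q'" for q
      using gp_propagate[of x' "inv z" q c2] gp_sym[of x' "inv z"] zx' x' z that Q' by (auto simp: M'_def)
    ultimately show "\<exists>z\<in>carrier G. len z > M \<and> (\<forall>q\<in>Q. gp z q \<le> c2 + \<delta>) \<and> (\<forall>q\<in>Q'. gp (inv z) q \<le> c2 + \<delta>)"
      using z by blast
  qed
qed

end

section \<open>Transverse loxodromic elements in normal subgroups\<close>

context acylindrical_group_metric
begin

text \<open>
  Let \<open>g\<close> be a long element of \<open>K\<close> and let \<open>inv z\<close> avoid \<open>g\<close> and \<open>inv g\<close>.  Then \<open>z \<otimes> g \<otimes> inv z\<close> and its
  inverse both start in the direction of \<open>z\<close>.  For two such \<open>z\<close>, \<open>z'\<close> in different directions, the product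
  of the two conjugates starts in the direction of \<open>z\<close> and its inverse in the direction of \<open>z'\<close>.
\<close>

lemma normal_subgroup_loxodromic:
  assumes K: "K \<lhd> G" and f: "f \<in> K" "f \<noteq> \<one>"
  obtains c where "0 \<le> c"
    and "\<And>p M. p \<in> carrier G \<Longrightarrow>
      \<exists>b\<in>K. len b > M \<and> gp b p \<le> c \<and> gp (inv b) p \<le> c \<and> gp b (inv b) \<le> c"
proof -
  have KG: "x \<in> carrier G" if "x \<in> K" for x
    using normal_imp_subgroup[OF K] subgroup.mem_carrier that by metis
  have K_conj: "x \<otimes> g \<otimes> inv x \<in> K" if "x \<in> carrier G" "g \<in> K" for x g
    using normal.inv_op_closed2[OF K] that by blast
  obtain c0 where c0: "0 \<le> c0" and both: "\<And>Q Q' M. \<lbrakk>Q \<subseteq> carrier G; finite Q; card Q \<le> 2;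
      Q' \<subseteq> carrier G; finite Q'; card Q' \<le> 2\<rbrakk> \<Longrightarrow>
      \<exists>z\<in>carrier G. len z > M \<and> (\<forall>q\<in>Q. gp z q \<le> c0) \<and> (\<forall>q\<in>Q'. gp (inv z) q \<le> c0)"
    using avoiding_both_ways[of 2] by metis
  have both2: "\<exists>z\<in>carrier G. len z > M \<and> gp z p \<le> c0 \<and> gp z p' \<le> c0 \<and> gp (inv z) q \<le> c0 \<and> gp (inv z) q' \<le> c0"
    if "p \<in> carrier G" "p' \<in> carrier G" "q \<in> carrier G" "q' \<in> carrier G" for p p' q q' M
    using both[of "{p, p'}" "{q, q'}" M] that by (simp add: card_insert_if)
  obtain a where a: "a \<in> carrier G" "D a (f \<otimes> a) > 2 * c0 + \<delta>"
    using exists_far_displaced[of "{f}" "2 * c0 + \<delta>"] f KG by auto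
  define g where "g = inv a \<otimes> f \<otimes> a"
  have gK: "g \<in> K"
    using K_conj[of "inv a" f] a f by (simp add: g_def)
  have g: "g \<in> carrier G" "len g > 2 * c0 + \<delta>"
    using KG[OF gK] D_eq_len[of a "f \<otimes> a"] a KG[OF f(1)] by (auto simp: g_def m_assoc)
  define conj where "conj z = z \<otimes> g \<otimes> inv z" for z
  have conj_near: "gp (conj z) z \<ge> len z - c0 - \<delta> \<and> gp (inv (conj z)) z \<ge> len z - c0 - \<delta>"
    if z: "z \<in> carrier G" "gp (inv z) g \<le> c0" "gp (inv z) (inv g) \<le> c0" for z
  proof
    show "gp (conj z) z \<ge> len z - c0 - \<delta>"
      unfolding conj_def using z g gp_sym[of g "inv z"] by (intro gp_product_of_three) auto
    have "inv (conj z) = z \<otimes> inv g \<otimes> inv z"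
      using z g by (simp add: conj_def inv_mult_group m_assoc)
    moreover have "gp (z \<otimes> inv g \<otimes> inv z) z \<ge> len z - c0 - \<delta>"
      using z g gp_sym[of "inv g" "inv z"] by (intro gp_product_of_three) (auto simp: len_inv)
    ultimately show "gp (inv (conj z)) z \<ge> len z - c0 - \<delta>"
      by simp
  qed
  define c where "c = c0 + 2 * \<delta>"
  show thesis
  proof (rule that[of c])
    show "0 \<le> c"
      using c0 delta_nonneg by (simp add: c_def)
    fix p M assume p: "p \<in> carrier G"
    define Z where "Z = max 0 M + 3 * c0 + 8 * \<delta>"
    have Z: "Z \<ge> 3 * c0 + 8 * \<delta>" "Z \<ge> M + 3 * c0 + 8 * \<delta>"
      by (simp_all add: Z_def)
    obtain z where z: "z \<in> carrier G" "len z > Z" "gp z p \<le> c0" "gp (inv z) g \<le> c0" "gp (inv z) (inv g) \<le> c0"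
      using both2[of p p g "inv g" Z] p g by auto
    obtain z' where z': "z' \<in> carrier G" "len z' > Z" "gp z' p \<le> c0" "gp z' z \<le> c0"
      "gp (inv z') g \<le> c0" "gp (inv z') (inv g) \<le> c0"
      using both2[of p z g "inv g" Z] p g z by auto
    define h h' where "h = conj z" and "h' = conj z'"
    have h: "h \<in> carrier G" "h' \<in> carrier G"
      using z z' g by (auto simp: h_def h'_def conj_def)
    have hz: "gp h z \<ge> len z - c0 - \<delta>" "gp (inv h) z \<ge> len z - c0 - \<delta>"
      using conj_near z by (auto simp: h_def)
    have hz': "gp h' z' \<ge> len z' - c0 - \<delta>" "gp (inv h') z' \<ge> len z' - c0 - \<delta>"
      using conj_near z' by (auto simp: h'_def)
    have sep: "gp x y \<le> c0 + 2 * \<delta>"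
      if "x \<in> carrier G" "y \<in> carrier G" "gp x z > c0 + 2 * \<delta>" "gp y z' > c0 + 2 * \<delta>" for x y
    proof -
      have "gp x z' \<le> c0 + \<delta>"
        using gp_propagate[of z x z' c0] gp_sym[of z x] gp_sym[of z z'] that z z' delta_nonneg by simp
      then have "gp y x \<le> c0 + \<delta> + \<delta>"
        using gp_propagate[of z' y x "c0 + \<delta>"] gp_sym[of z' y] gp_sym[of z' x] that z z' by simp
      then show ?thesis
        using gp_sym that by simp
    qed
    define b where "b = h \<otimes> h'"
    have b: "b \<in> carrier G" "inv b = inv h' \<otimes> inv h"
      using h by (auto simp: b_def inv_mult_group)
    have "gp (inv h) h' \<le> c0 + 2 * \<delta>"
      using hz hz' z z' h c0 delta_nonneg Z by (intro sep) auto
    then have "gp b h \<ge> len h - c0 - 2 * \<delta>" "gp (inv b) (inv h') \<ge> len h' - c0 - 2 * \<delta>"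
      using gp_mult_left[of h h'] gp_mult_left[of "inv h'" "inv h"] h gp_sym[of "inv h" h']
      by (simp_all add: b len_inv b_def[symmetric])
    moreover have "len h \<ge> len z - c0 - \<delta>" "len h' \<ge> len z' - c0 - \<delta>"
      using gp_le_len[of h z] gp_le_len[of h' z'] hz hz' h z z' by auto
    ultimately have bh: "gp b h \<ge> len z - 2 * c0 - 3 * \<delta>" "gp (inv b) (inv h') \<ge> len z' - 2 * c0 - 3 * \<delta>"
      by auto
    have bz: "gp b z \<ge> len z - 2 * c0 - 4 * \<delta>"
      using gp_min[of b h z] bh hz b h z c0 delta_nonneg Z by (auto simp: min_def split: if_splits)
    have bz': "gp (inv b) z' \<ge> len z' - 2 * c0 - 4 * \<delta>"
      using gp_min[of "inv b" "inv h'" z'] bh hz' b h z' c0 delta_nonneg Z by (auto simp: min_def split: if_splits)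
    have "b \<in> K"
      using K_conj[OF z(1) gK] K_conj[OF z'(1) gK] normal_imp_subgroup[OF K]
      by (simp add: b_def h_def h'_def conj_def subgroup.m_closed)
    moreover have "len b > M"
      using gp_le_len[of b z] bz b z c0 delta_nonneg Z by simp
    moreover have "gp b p \<le> c"
      using gp_propagate[of z b p c0] gp_sym[of z b] bz b z p c0 delta_nonneg Z by (simp add: c_def)
    moreover have "gp (inv b) p \<le> c"
      using gp_propagate[of z' "inv b" p c0] gp_sym[of z' "inv b"] bz' b(1) z' p c0 delta_nonneg Z
      by (simp add: c_def)
    moreover have "gp b (inv b) \<le> c"
      unfolding c_def using bz bz' b(1) z z' c0 delta_nonneg Z by (intro sep) auto
    ultimately show "\<exists>b\<in>K. len b > M \<and> gp b p \<le> c \<and> gp (inv b) p \<le> c \<and> gp b (inv b) \<le> c"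
      by blast
  qed
qed

text \<open>
  Both \<open>k = a \<otimes> b \<otimes> inv a\<close> and its inverse start in the direction of \<open>a\<close>, up to an error \<open>c\<close> that does not
  depend on \<open>a\<close>.  All \<open>f \<in> F\<close> displace \<open>a\<close> so far that the directions of \<open>a\<close> and \<open>f \<otimes> a\<close> separate before
  this error matters, which separates \<open>k\<close> from \<open>f \<otimes> k\<close>.  The length of \<open>b\<close> is chosen last, and it
  dominates all other quantities.
\<close>

lemma normal_subgroup_transverse_loxodromic:
  assumes K: "K \<lhd> G" "K \<noteq> {\<one>}" and F: "finite F" "F \<subseteq> carrier G - {\<one>}"
  obtains k where "k \<in> K" "gp k (inv k) < len k / 2 - \<delta>"
    "\<And>f x y. \<lbrakk>f \<in> F; x \<in> {k, inv k}; y \<in> {k, inv k}\<rbrakk> \<Longrightarrow> gp x (f \<otimes> y) < len k / 2 - len f - \<delta>"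
proof -
  have KG: "x \<in> carrier G" if "x \<in> K" for x
    using normal_imp_subgroup[OF K(1)] subgroup.mem_carrier that by metis
  have "\<one> \<in> K"
    using normal_imp_subgroup[OF K(1)] subgroup.one_closed by blast
  then obtain f0 where f0: "f0 \<in> K" "f0 \<noteq> \<one>"
    using K(2) by blast
  obtain c where c: "0 \<le> c" and lox: "\<And>p M. p \<in> carrier G \<Longrightarrow>
      \<exists>b\<in>K. len b > M \<and> gp b p \<le> c \<and> gp (inv b) p \<le> c \<and> gp b (inv b) \<le> c"
    using normal_subgroup_loxodromic[OF K(1) f0] by metis
  define L where "L = (\<Sum>f\<in>F. len f)"
  have FG: "f \<in> carrier G" if "f \<in> F" for f
    using F that by auto
  have L: "len f \<le> L" if "f \<in> F" for f
    unfolding L_def using F that FG len_nonneg by (intro member_le_sum) auto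
  have L0: "0 \<le> L"
    unfolding L_def using FG len_nonneg by (intro sum_nonneg) auto
  obtain a where a: "a \<in> carrier G" "\<And>f. f \<in> F \<Longrightarrow> D a (f \<otimes> a) > 2 * c + 3 * L + 6 * \<delta>"
    using exists_far_displaced[OF F, of "2 * c + 3 * L + 6 * \<delta>"] by blast
  \<comment> \<open>the factor eight: \<open>3 * len a + c\<close> will bound \<open>gp k (inv k)\<close> and must stay below half of \<open>len b - 2 * len a\<close>\<close>
  define M where "M = 8 * len a + 2 * c + 2 * L + 4 * \<delta>"
  obtain b where b: "b \<in> K" "len b > M" "gp b (inv a) \<le> c" "gp (inv b) (inv a) \<le> c" "gp b (inv b) \<le> c"
    using lox[of "inv a" M] a by auto
  define k where "k = a \<otimes> b \<otimes> inv a"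
  have bG: "b \<in> carrier G"
    using KG b by blast
  have k: "k \<in> carrier G" "inv k = a \<otimes> inv b \<otimes> inv a"
    using a bG by (auto simp: k_def inv_mult_group m_assoc)
  have kK: "k \<in> K"
    using normal.inv_op_closed2[OF K(1) a(1) b(1)] by (simp add: k_def)
  have a0: "len a \<ge> 0"
    using len_nonneg a by blast
  have "2 * c + \<delta> < len b"
    using b(2) a0 L0 delta_nonneg by (simp add: M_def)
  then have ka: "gp k a \<ge> len a - c - \<delta>" "gp (inv k) a \<ge> len a - c - \<delta>"
    unfolding k(2) unfolding k_def
    using a bG b gp_sym[of "inv a" "inv b"] gp_sym[of "inv a" b]
    by (auto intro!: gp_product_of_three simp: len_inv)
  have len_k: "len k \<ge> len b - 2 * len a"
    using len_mult_ge[of "a \<otimes> b" "inv a"] len_mult_ge'[of a b] a bG by (simp add: k_def len_inv)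
  have "gp k (inv k) \<le> gp (b \<otimes> inv a) (inv b \<otimes> inv a) + len a"
    using gp_translate_le[of a "b \<otimes> inv a" "inv b \<otimes> inv a"] a bG unfolding k(2) unfolding k_def
    by (simp add: m_assoc)
  also have "gp (b \<otimes> inv a) (inv b \<otimes> inv a) \<le> gp b (inv b \<otimes> inv a) + len a"
    using gp_mult_right_le[of b "inv a" "inv b \<otimes> inv a"] a bG by (simp add: len_inv)
  also have "gp b (inv b \<otimes> inv a) \<le> gp b (inv b) + len a"
    using gp_mult_right_le[of "inv b" "inv a" b] a bG gp_sym[of b] by (simp add: len_inv)
  finally have kk: "gp k (inv k) \<le> 3 * len a + c"
    using b by simp
  show thesis
  proof (rule that[OF kK])
    show "gp k (inv k) < len k / 2 - \<delta>"
      using kk len_k b(2) L0 delta_nonneg a0 c by (simp add: M_def)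
    fix f x y assume f: "f \<in> F" and xy: "x \<in> {k, inv k}" "y \<in> {k, inv k}"
    have fG: "f \<in> carrier G"
      using FG f by blast
    have xyG: "x \<in> carrier G" "y \<in> carrier G"
      using xy k(1) by auto
    have xya: "gp x a \<ge> len a - c - \<delta>" "gp y a \<ge> len a - c - \<delta>"
      using xy ka by auto
    show "gp x (f \<otimes> y) < len k / 2 - len f - \<delta>"
    proof (rule ccontr)
      assume "\<not> ?thesis"
      then have big: "gp x (f \<otimes> y) \<ge> len a"
        using len_k b(2) L[OF f] L0 delta_nonneg a0 c by (simp add: M_def)
      have fya: "gp (f \<otimes> y) (f \<otimes> a) \<ge> len a - c - \<delta> - len f"
        using gp_translate_ge[of f y a] xya fG xyG a by simp
      have f0: "len f \<ge> 0"
        using len_nonneg fG by blast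
      have "gp a (f \<otimes> y) \<ge> len a - c - 2 * \<delta>"
        using gp_min[of a x "f \<otimes> y"] gp_sym[of a x] big xya c delta_nonneg a fG xyG
        by (simp add: min_def split: if_splits)
      then have "gp a (f \<otimes> a) \<ge> len a - c - len f - 3 * \<delta>"
        using gp_min[of a "f \<otimes> y" "f \<otimes> a"] fya f0 a fG xyG delta_nonneg
        by (simp add: min_def split: if_splits)
      moreover have "2 * gp a (f \<otimes> a) = len a + len (f \<otimes> a) - D a (f \<otimes> a)"
        using a fG by (simp add: gp_eq)
      moreover have "len (f \<otimes> a) \<le> len f + len a"
        using len_mult_le a fG by blast
      ultimately show False
        using a(2)[OF f] L[OF f] by simp
    qed
  qed
qed

text \<open>
  Halving \<open>len k\<close> makes the two shadows \<open>A\<close> and \<open>B\<close> complementary under \<open>k\<close>, by \<open>gp_mult_left\<close>; they are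
  disjoint and displaced by \<open>F\<close> because otherwise a common point would force one of the Gromov
  products bounded in \<open>normal_subgroup_transverse_loxodromic\<close> to be large.
\<close>

lemma normal_subgroup_ping_pong:
  assumes K: "K \<lhd> G" "K \<noteq> {\<one>}" and F: "finite F" "F \<subseteq> carrier G - {\<one>}"
  obtains k A B where "k \<in> K" "A \<subseteq> carrier G" "B \<subseteq> carrier G" "A \<inter> B = {}"
    "\<And>y. \<lbrakk>y \<in> carrier G; y \<notin> B\<rbrakk> \<Longrightarrow> k \<otimes> y \<in> A"
    "\<And>f x y. \<lbrakk>f \<in> F; x \<in> A \<union> B; y \<in> A \<union> B\<rbrakk> \<Longrightarrow> f \<otimes> x \<noteq> y"
proof -
  obtain k where k: "k \<in> K" "gp k (inv k) < len k / 2 - \<delta>"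
    and kF: "\<And>f x y. \<lbrakk>f \<in> F; x \<in> {k, inv k}; y \<in> {k, inv k}\<rbrakk> \<Longrightarrow> gp x (f \<otimes> y) < len k / 2 - len f - \<delta>"
    using normal_subgroup_transverse_loxodromic[OF assms] by metis
  have kG: "k \<in> carrier G"
    using normal_imp_subgroup[OF K(1)] subgroup.mem_carrier k(1) by metis
  define A where "A = {y \<in> carrier G. gp y k \<ge> len k / 2}"
  define B where "B = {y \<in> carrier G. gp y (inv k) \<ge> len k / 2}"
  show thesis
  proof (rule that[OF k(1)])
    show "A \<subseteq> carrier G" "B \<subseteq> carrier G"
      by (auto simp: A_def B_def)
    show "A \<inter> B = {}"
    proof (rule ccontr)
      assume "A \<inter> B \<noteq> {}"
      then obtain y where "y \<in> carrier G" "gp y k \<ge> len k / 2" "gp y (inv k) \<ge> len k / 2"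
        by (auto simp: A_def B_def)
      then show False
        using gp_min[of k y "inv k"] gp_sym[of k y] kG k(2) by simp
    qed
    show "k \<otimes> y \<in> A" if "y \<in> carrier G" "y \<notin> B" for y
      using that gp_mult_left[of k y] kG by (simp add: A_def B_def)
    fix f x y assume f: "f \<in> F" and xy: "x \<in> A \<union> B" "y \<in> A \<union> B"
    have fG: "f \<in> carrier G"
      using F f by auto
    obtain \<xi> where \<xi>: "\<xi> \<in> {k, inv k}" "x \<in> carrier G" "gp x \<xi> \<ge> len k / 2"
      using xy(1) by (auto simp: A_def B_def)
    obtain \<eta> where \<eta>: "\<eta> \<in> {k, inv k}" "y \<in> carrier G" "gp y \<eta> \<ge> len k / 2"
      using xy(2) by (auto simp: A_def B_def)
    have carr: "\<xi> \<in> carrier G" "\<eta> \<in> carrier G"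
      using \<xi> \<eta> kG by auto
    show "f \<otimes> x \<noteq> y"
    proof
      assume eq: "f \<otimes> x = y"
      have "gp y (f \<otimes> \<xi>) \<ge> len k / 2 - len f"
        using gp_translate_ge[of f x \<xi>] \<xi> carr fG eq by simp
      then have "gp \<eta> (f \<otimes> \<xi>) \<ge> len k / 2 - len f - \<delta>"
        using gp_min[of \<eta> y "f \<otimes> \<xi>"] gp_sym[of \<eta> y] \<eta> carr fG len_nonneg[OF fG] by simp
      then show False
        using kF[OF f \<eta>(1) \<xi>(1)] by simp
    qed
  qed
qed

end

section \<open>The orbit pseudometric of a non-elementary acylindrical action\<close>

lemma filterlim_double_sequence_iff:
  fixes f :: "nat \<Rightarrow> nat \<Rightarrow> real"
  shows "filterlim (\<lambda>(m, n). f m n) at_top (sequentially \<times>\<^sub>F sequentially) \<longleftrightarrow>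
    (\<forall>B. \<exists>N. \<forall>m\<ge>N. \<forall>n\<ge>N. f m n > B)"
  unfolding filterlim_at_top_dense eventually_prod_sequentially by (auto; blast)

locale hyperbolic_points = Metric_space X d for X :: "'x set" and d +
  fixes \<delta> :: real
  assumes delta: "0 \<le> \<delta>"
    and four_points: "\<lbrakk>w \<in> X; x \<in> X; y \<in> X; z \<in> X\<rbrakk> \<Longrightarrow>
      gromov_product d w x z \<ge> min (gromov_product d w x y) (gromov_product d w y z) - \<delta>"
begin

abbreviation "\<gamma> \<equiv> gromov_product d"

lemma gromov_product_sym: "\<gamma> w x y = \<gamma> w y x"
  by (simp add: gromov_product_def commute)

lemma gromov_product_move:
  assumes "w \<in> X" "x \<in> X" "y \<in> X" "x' \<in> X" "y' \<in> X"
  shows "\<gamma> w x' y' \<le> \<gamma> w x y + d x x' + d y y'"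
proof -
  have "d x' w \<le> d x x' + d x w" "d y' w \<le> d y y' + d y w"
    using triangle[of x' x w] triangle[of y' y w] assms by (simp_all add: commute)
  moreover have "d x y \<le> d x x' + d x' y' + d y y'"
    using triangle[of x x' y] triangle[of x' y' y] assms by (simp add: commute[of y])
  ultimately show ?thesis
    by (simp add: gromov_product_def field_simps)
qed

lemma gromov_product_move_base:
  assumes "w \<in> X" "v \<in> X" "x \<in> X" "y \<in> X"
  shows "\<gamma> v x y \<le> \<gamma> w x y + d w v"
  using triangle[of x w v] triangle[of y w v] assms by (simp add: gromov_product_def field_simps)

lemma gromov_product_diag: "x \<in> X \<Longrightarrow> \<gamma> w x x = d x w"
  by (simp add: gromov_product_def)

lemma converges_to_infinity_iff:
  "converges_to_infinity X d s \<longleftrightarrow>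
     range s \<subseteq> X \<and> (\<forall>w\<in>X. \<forall>B. \<exists>N. \<forall>m\<ge>N. \<forall>n\<ge>N. \<gamma> w (s m) (s n) > B)"
  by (simp add: converges_to_infinity_def filterlim_double_sequence_iff)

lemma boundary_rel_iff:
  "(s, t) \<in> boundary_rel X d \<longleftrightarrow> converges_to_infinity X d s \<and> converges_to_infinity X d t \<and>
     (\<forall>w\<in>X. \<forall>B. \<exists>N. \<forall>m\<ge>N. \<forall>n\<ge>N. \<gamma> w (s m) (t n) > B)"
  by (simp add: boundary_rel_def filterlim_double_sequence_iff)

lemma boundary_rel_sym:
  assumes "(s, t) \<in> boundary_rel X d"
  shows "(t, s) \<in> boundary_rel X d"
  using assms unfolding boundary_rel_iff gromov_product_sym[of _ "t _"] by blast

lemma boundary_rel_trans: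
  assumes st: "(s, t) \<in> boundary_rel X d" and tu: "(t, u) \<in> boundary_rel X d"
  shows "(s, u) \<in> boundary_rel X d"
  unfolding boundary_rel_iff
proof (intro conjI ballI allI)
  show conv: "converges_to_infinity X d s" "converges_to_infinity X d u"
    using st tu by (auto simp: boundary_rel_iff)
  have X: "s n \<in> X" "t n \<in> X" "u n \<in> X" for n
    using st tu by (auto simp: boundary_rel_iff converges_to_infinity_iff)
  fix w B assume w: "w \<in> X"
  obtain N1 where N1: "\<forall>m\<ge>N1. \<forall>n\<ge>N1. \<gamma> w (s m) (t n) > B + \<delta>"
    using st w unfolding boundary_rel_iff by blast
  obtain N2 where N2: "\<forall>m\<ge>N2. \<forall>n\<ge>N2. \<gamma> w (t m) (u n) > B + \<delta>"
    using tu w unfolding boundary_rel_iff by blast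
  have "\<gamma> w (s m) (u n) > B" if "m \<ge> max N1 N2" "n \<ge> max N1 N2" for m n
    using four_points[OF w X(1,2,3), of m "max N1 N2" n] N1[rule_format, of m "max N1 N2"]
      N2[rule_format, of "max N1 N2" n] that by (simp add: min_def split: if_splits)
  then show "\<exists>N. \<forall>m\<ge>N. \<forall>n\<ge>N. \<gamma> w (s m) (u n) > B"
    by blast
qed

lemma boundary_class_eqI:
  assumes "(s, t) \<in> boundary_rel X d"
  shows "boundary_rel X d `` {s} = boundary_rel X d `` {t}"
  using assms boundary_rel_sym boundary_rel_trans by blast

text \<open>
  A single pair of far members with small Gromov product bounds all of them, since the members of each
  sequence eventually have large Gromov products among themselves.
\<close>

lemma distinct_boundary_points_bounded:
  assumes s: "converges_to_infinity X d s" and t: "converges_to_infinity X d t"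
    and st: "(s, t) \<notin> boundary_rel X d" and p: "p \<in> X"
  shows "\<exists>B N. \<forall>m\<ge>N. \<forall>n\<ge>N. \<gamma> p (s m) (t n) \<le> B"
proof -
  have X: "s n \<in> X" "t n \<in> X" for n
    using s t by (auto simp: converges_to_infinity_iff)
  obtain w B where w: "w \<in> X" and B: "\<And>N. \<exists>m\<ge>N. \<exists>n\<ge>N. \<gamma> w (s m) (t n) \<le> B"
    using s t st unfolding boundary_rel_iff by (meson not_less)
  obtain N1 where N1: "\<forall>m\<ge>N1. \<forall>n\<ge>N1. \<gamma> w (s m) (s n) > B + 2 * \<delta>"
    using s w unfolding converges_to_infinity_iff by blast
  obtain N2 where N2: "\<forall>m\<ge>N2. \<forall>n\<ge>N2. \<gamma> w (t m) (t n) > B + 2 * \<delta>"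
    using t w unfolding converges_to_infinity_iff by blast
  define N where "N = max N1 N2"
  obtain a b where ab: "a \<ge> N" "b \<ge> N" "\<gamma> w (s a) (t b) \<le> B"
    using B by blast
  have "\<gamma> p (s m) (t n) \<le> B + 2 * \<delta> + d w p" if mn: "m \<ge> N" "n \<ge> N" for m n
  proof -
    have "\<gamma> w (s a) (s m) > B + 2 * \<delta>" "\<gamma> w (t n) (t b) > B + 2 * \<delta>"
      using N1[rule_format, of a m] N2[rule_format, of n b] ab mn by (auto simp: N_def)
    then have "\<gamma> w (s m) (t n) \<le> B + 2 * \<delta>"
      using four_points[OF w X(1,1,2), of a m b] four_points[OF w X(1,2,2), of m n b] ab(3) delta
      by (simp add: min_def split: if_splits)
    then show ?thesis
      using gromov_product_move_base[OF w p X(1,2), of m n] by simp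
  qed
  then show ?thesis
    by blast
qed

end

text \<open>
  Representatives of three limit points, pulled back to the group along their orbits, give the three
  divergent sequences.  The limit points may be accumulated by orbits of different points; moving
  all orbits to the base point \<open>p\<close> changes Gromov products by a bounded amount.
\<close>

theorem acylindrically_hyperbolic_group_metric:
  fixes G :: "('g, 'm) monoid_scheme"
  assumes "group G" "acylindrically_hyperbolic TYPE('x) G" "is_finite_radical G {\<one>\<^bsub>G\<^esub>}"
  shows "\<exists>D \<delta>. acylindrical_group_metric G D \<delta>"
proof -
  obtain X :: "'x set" and d \<rho> where hyp: "gromov_hyperbolic X d" and act: "isometric_action G X d \<rho>"
    and acyl: "acylindrical_action G X d \<rho>" and non_elem: "\<not> elementary_action G X d \<rho>"
    using assms(2) by (auto simp: acylindrically_hyperbolic_def)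
  obtain \<delta> where M: "Metric_space X d" and \<delta>: "\<delta> \<ge> 0"
    "\<And>w x y z. \<lbrakk>w \<in> X; x \<in> X; y \<in> X; z \<in> X\<rbrakk> \<Longrightarrow>
      gromov_product d w x z \<ge> min (gromov_product d w x y) (gromov_product d w y z) - \<delta>"
    using hyp unfolding gromov_hyperbolic_def by blast
  interpret hyperbolic_points X d \<delta>
    by (intro hyperbolic_points.intro hyperbolic_points_axioms.intro M \<delta>)
  interpret group G
    by fact
  interpret group_action G X \<rho>
    using act by (simp add: isometric_action_def)
  have iso: "d (\<rho> g x) (\<rho> g y) = d x y" if "g \<in> carrier G" "x \<in> X" "y \<in> X" for g x y
    using act that by (simp add: isometric_action_def)
  note in_X = element_image[OF _ _ refl]
  have "\<exists>T \<subseteq> limit_set G X d \<rho>. finite T \<and> card T = 3"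
  proof (cases "finite (limit_set G X d \<rho>)")
    case True
    then have "3 \<le> card (limit_set G X d \<rho>)"
      using non_elem by (simp add: elementary_action_def)
    then show ?thesis
      using obtain_subset_with_card_n by metis
  next
    case False
    then show ?thesis
      using infinite_arbitrarily_large by blast
  qed
  then obtain T where T: "T \<subseteq> limit_set G X d \<rho>" "finite T" "card T = 3"
    by blast
  obtain A where A: "bij_betw A {0..<3::nat} T"
    using ex_bij_betw_nat_finite[OF T(2)] T(3) by auto
  have "\<exists>s x. A i = boundary_rel X d `` {s} \<and> converges_to_infinity X d s \<and> x \<in> X \<and> range s \<subseteq> orbit G \<rho> x"
    if "i < 3" for i
  proof -
    have "A i \<in> limit_set G X d \<rho>"
      using A T(1) that by (auto simp: bij_betw_def)
    then show ?thesis
      by (auto simp: limit_set_def)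
  qed
  then obtain s x where s: "\<And>i. i < 3 \<Longrightarrow> A i = boundary_rel X d `` {s i}"
    "\<And>i. i < 3 \<Longrightarrow> converges_to_infinity X d (s i)" and x: "\<And>i. i < 3 \<Longrightarrow> x i \<in> X"
    and orb: "\<And>i. i < 3 \<Longrightarrow> range (s i) \<subseteq> orbit G \<rho> (x i)"
    by metis
  have "\<exists>g. g \<in> carrier G \<and> \<rho> g (x i) = s i n" if "i < 3" for i n
  proof -
    have "s i n \<in> orbit G \<rho> (x i)"
      using orb[OF that] by blast
    then show ?thesis
      unfolding orbit_def by force
  qed
  then obtain g where g: "\<And>i n. i < 3 \<Longrightarrow> g i n \<in> carrier G" "\<And>i n. i < 3 \<Longrightarrow> \<rho> (g i n) (x i) = s i n"
    by metis
  define p where "p = x 0"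
  have p: "p \<in> X"
    using x by (simp add: p_def)
  define D where "D a b = d (\<rho> a p) (\<rho> b p)" for a b
  have one: "\<rho> \<one>\<^bsub>G\<^esub> p = p"
    using id_eq_one p by (metis restrict_apply')
  interpret H: hyperbolic_group_metric G D \<delta>
  proof (unfold_locales, goal_cases)
    case (1 x)
    then show ?case
      using in_X p by (simp add: D_def)
  next
    case (2 x y)
    then show ?case
      by (simp add: D_def commute)
  next
    case (3 x y z)
    then show ?case
      using in_X p by (simp add: D_def triangle)
  next
    case (4 g x y)
    then show ?case
      using in_X p by (simp add: D_def composition_rule iso)
  next
    case 5
    then show ?case
      using \<delta> by simp
  next
    case (6 x y z)
    then show ?case
      using \<delta>(2)[of p "\<rho> x p" "\<rho> y p" "\<rho> z p"] in_X p by (simp add: gromov_product_def D_def one)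
  qed
  have gp_D: "gromov_product D \<one>\<^bsub>G\<^esub> a b = \<gamma> p (\<rho> a p) (\<rho> b p)" for a b
    by (simp add: gromov_product_def D_def one)
  have not_rel: "(s i, s j) \<notin> boundary_rel X d" if "i < 3" "j < 3" "i \<noteq> j" for i j
  proof
    assume "(s i, s j) \<in> boundary_rel X d"
    then have "A i = A j"
      using boundary_class_eqI s that by auto
    then show False
      using A that by (auto simp: bij_betw_def inj_on_def)
  qed
  have "\<exists>B N. \<forall>m\<ge>N. \<forall>n\<ge>N. \<gamma> p (s i m) (s j n) \<le> B" if "i < 3" "j < 3" "i \<noteq> j" for i j
    using distinct_boundary_points_bounded[OF s(2) s(2) not_rel p] that by blast
  then obtain B N where BN: "\<And>i j m n. \<lbrakk>i < 3; j < 3; i \<noteq> j; m \<ge> N i j; n \<ge> N i j\<rbrakk> \<Longrightarrow>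
      \<gamma> p (s i m) (s j n) \<le> B i j"
    by metis
  define N0 where "N0 = Max ((\<lambda>(i, j). N i j) ` ({..<3} \<times> {..<3}))"
  have N0: "N i j \<le> N0" if "i < 3" "j < 3" for i j
    unfolding N0_def using that by (intro Max_ge) force+
  define c where "c = Max ((\<lambda>(i, j). B i j + d (x i) p + d (x j) p) ` ({..<3} \<times> {..<3}))"
  have c: "B i j + d (x i) p + d (x j) p \<le> c" if "i < 3" "j < 3" for i j
    unfolding c_def using that by (intro Max_ge) force+
  define s' where "s' i n = g i (N0 + n)" for i n
  have near: "d (s i (N0 + n)) (\<rho> (s' i n) p) = d (x i) p" if "i < 3" for i n
    using g that iso[OF g(1) x p] by (metis s'_def)
  have sX: "s i n \<in> X" if "i < 3" for i n
    using s(2)[OF that] by (auto simp: converges_to_infinity_iff)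
  have s'X: "\<rho> (s' i n) p \<in> X" if "i < 3" for i n
    using in_X g p that by (simp add: s'_def)
  have "H.ends 3 c s'"
    unfolding H.ends_def
  proof (intro conjI allI impI)
    fix i n assume "i < (3::nat)"
    then show "s' i n \<in> carrier G"
      using g by (simp add: s'_def)
  next
    fix i assume i: "i < (3::nat)"
    show "filterlim (\<lambda>n. H.len (s' i n)) at_top sequentially"
      unfolding filterlim_at_top_dense eventually_sequentially
    proof
      fix Z
      obtain M where M: "\<forall>m\<ge>M. \<forall>n\<ge>M. \<gamma> p (s i m) (s i n) > Z + d (x i) p"
        using s(2)[OF i] p unfolding converges_to_infinity_iff by blast
      have "Z < H.len (s' i n)" if "n \<ge> M" for n
      proof -
        have "Z + d (x i) p < d (s i (N0 + n)) p"
          using M[rule_format, of "N0 + n" "N0 + n"] that gromov_product_diag[OF sX[OF i]] by simp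
        also have "\<dots> \<le> d (s i (N0 + n)) (\<rho> (s' i n) p) + d (\<rho> (s' i n) p) p"
          using triangle sX s'X i p by blast
        finally show ?thesis
          using near[OF i, of n] by (simp add: H.len_def D_def one commute)
      qed
      then show "\<exists>N. \<forall>n\<ge>N. Z < H.len (s' i n)"
        by blast
    qed
  next
    fix i j n k assume ij: "i < (3::nat)" "j < (3::nat)" "i \<noteq> j"
    have "\<gamma> p (\<rho> (s' i n) p) (\<rho> (s' j k) p) \<le> \<gamma> p (s i (N0 + n)) (s j (N0 + k)) + d (x i) p + d (x j) p"
      using gromov_product_move[OF p sX[OF ij(1), of "N0 + n"] sX[OF ij(2), of "N0 + k"] s'X[OF ij(1), of n]
          s'X[OF ij(2), of k]] near ij by simp
    also have "\<dots> \<le> c"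
      using BN[of i j "N0 + n" "N0 + k"] N0[of i j] c[of i j] ij by simp
    finally show "H.gp (s' i n) (s' j k) \<le> c"
      by (simp add: H.gp_def gp_D)
  qed
  moreover have "\<exists>R (N::nat). \<forall>x\<in>carrier G. \<forall>y\<in>carrier G. D x y \<ge> R \<longrightarrow>
        finite {g \<in> carrier G. D x (g \<otimes>\<^bsub>G\<^esub> x) \<le> \<epsilon> \<and> D y (g \<otimes>\<^bsub>G\<^esub> y) \<le> \<epsilon>} \<and>
        card {g \<in> carrier G. D x (g \<otimes>\<^bsub>G\<^esub> x) \<le> \<epsilon> \<and> D y (g \<otimes>\<^bsub>G\<^esub> y) \<le> \<epsilon>} \<le> N"
    if "\<epsilon> > 0" for \<epsilon>
  proof -
    obtain R and N :: nat where R: "\<forall>x\<in>X. \<forall>y\<in>X. d x y \<ge> R \<longrightarrow>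
        finite {g \<in> carrier G. d x (\<rho> g x) \<le> \<epsilon> \<and> d y (\<rho> g y) \<le> \<epsilon>} \<and>
        card {g \<in> carrier G. d x (\<rho> g x) \<le> \<epsilon> \<and> d y (\<rho> g y) \<le> \<epsilon>} \<le> N"
      using acyl \<open>\<epsilon> > 0\<close> unfolding acylindrical_action_def by meson
    have "{g \<in> carrier G. D x (g \<otimes>\<^bsub>G\<^esub> x) \<le> \<epsilon> \<and> D y (g \<otimes>\<^bsub>G\<^esub> y) \<le> \<epsilon>} =
        {g \<in> carrier G. d (\<rho> x p) (\<rho> g (\<rho> x p)) \<le> \<epsilon> \<and> d (\<rho> y p) (\<rho> g (\<rho> y p)) \<le> \<epsilon>}"
      if "x \<in> carrier G" "y \<in> carrier G" for x y
      using that p by (auto simp: D_def composition_rule)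
    then show ?thesis
      using R in_X p by (intro exI[of _ R] exI[of _ N]) (auto simp: D_def)
  qed
  moreover have "N \<subseteq> {\<one>\<^bsub>G\<^esub>}" if "N \<lhd> G" "finite N" for N
    using assms(3) that by (simp add: is_finite_radical_def)
  ultimately have "acylindrical_group_metric G D \<delta>"
    by unfold_locales blast+
  then show ?thesis
    by blast
qed

section \<open>Averages over symmetric uniform measures\<close>

text \<open>
  Multiply the weights by a large \<open>m\<close>, round down, and give the remainder to one point \<open>g0\<close>; each
  multiplicity is then off by at most the size of the support.
\<close>

lemma pmf_uniform_approximation:
  fixes f :: "'g \<Rightarrow> 'b \<Rightarrow> 'v::real_normed_vector"
  assumes \<mu>: "finite (set_pmf \<mu>)" and F: "finite F" and e: "0 < e"
  obtains m :: nat and s where "0 < m" "\<And>i. i < m \<Longrightarrow> s i \<in> set_pmf \<mu>"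
    "\<And>a. a \<in> F \<Longrightarrow> norm ((1 / m) *\<^sub>R (\<Sum>i<m. f (s i) a) - (\<Sum>g\<in>set_pmf \<mu>. pmf \<mu> g *\<^sub>R f g a)) < e"
proof -
  define S where "S = set_pmf \<mu>"
  have S: "finite S" "S \<noteq> {}"
    using \<mu> set_pmf_not_empty by (auto simp: S_def)
  then obtain g0 where g0: "g0 \<in> S"
    by blast
  have sum_pmf: "(\<Sum>g\<in>S. pmf \<mu> g) = 1"
    unfolding S_def using \<mu> by (simp add: sum_pmf_eq_1)
  define B where "B = (\<Sum>a\<in>F. \<Sum>g\<in>S. norm (f g a))"
  have B: "(\<Sum>g\<in>S. norm (f g a)) \<le> B" if "a \<in> F" for a
    unfolding B_def using that F by (intro member_le_sum) (auto intro: sum_nonneg)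
  have B0: "0 \<le> B"
    unfolding B_def by (intro sum_nonneg) auto
  obtain m :: nat where m: "real (card S) * B / e < real m"
    using reals_Archimedean2 by blast
  have "0 \<le> real (card S) * B / e"
    using B0 e by simp
  with m have m0: "0 < m"
    by (metis of_nat_0_less_iff order_le_less_trans)
  define n where "n g = (if g = g0 then m - (\<Sum>h\<in>S - {g0}. nat \<lfloor>m * pmf \<mu> h\<rfloor>) else nat \<lfloor>m * pmf \<mu> g\<rfloor>)" for g
  have floor_n: "real (nat \<lfloor>m * pmf \<mu> g\<rfloor>) \<le> m * pmf \<mu> g" "m * pmf \<mu> g - 1 \<le> real (nat \<lfloor>m * pmf \<mu> g\<rfloor>)" for g
    by (simp_all add: of_nat_floor)
  have split: "(\<Sum>g\<in>S. pmf \<mu> g) = pmf \<mu> g0 + (\<Sum>g\<in>S - {g0}. pmf \<mu> g)"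
    using sum.remove[OF S(1) g0] .
  have "real (\<Sum>h\<in>S - {g0}. nat \<lfloor>m * pmf \<mu> h\<rfloor>) \<le> (\<Sum>h\<in>S - {g0}. m * pmf \<mu> h)"
    unfolding of_nat_sum by (intro sum_mono floor_n)
  also have "\<dots> = m * (1 - pmf \<mu> g0)"
    using split sum_pmf by (simp add: sum_distrib_left[symmetric])
  finally have rest: "real (\<Sum>h\<in>S - {g0}. nat \<lfloor>m * pmf \<mu> h\<rfloor>) \<le> m * (1 - pmf \<mu> g0)" .
  also have "\<dots> \<le> m"
    by (simp add: mult_left_le)
  finally have rest_le: "(\<Sum>h\<in>S - {g0}. nat \<lfloor>m * pmf \<mu> h\<rfloor>) \<le> m"
    by linarith
  have sum_n: "(\<Sum>g\<in>S. n g) = m"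
  proof -
    have "(\<Sum>g\<in>S. n g) = n g0 + (\<Sum>g\<in>S - {g0}. n g)"
      using sum.remove[OF S(1) g0] .
    also have "(\<Sum>g\<in>S - {g0}. n g) = (\<Sum>g\<in>S - {g0}. nat \<lfloor>m * pmf \<mu> g\<rfloor>)"
      by (rule sum.cong) (auto simp: n_def)
    finally show ?thesis
      using rest_le by (simp add: n_def)
  qed
  have card_S: "1 \<le> real (card S)"
    using S by (simp add: Suc_le_eq card_gt_0_iff)
  have n_close: "\<bar>real (n g) - m * pmf \<mu> g\<bar> \<le> card S" if g: "g \<in> S" for g
  proof (cases "g = g0")
    case False
    then have "n g = nat \<lfloor>m * pmf \<mu> g\<rfloor>"
      by (simp add: n_def)
    then have "\<bar>real (n g) - m * pmf \<mu> g\<bar> \<le> 1"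
      using floor_n[of g] by linarith
    then show ?thesis
      using card_S by linarith
  next
    case True
    have "real (\<Sum>h\<in>S - {g0}. nat \<lfloor>m * pmf \<mu> h\<rfloor>) \<ge> (\<Sum>h\<in>S - {g0}. m * pmf \<mu> h - 1)"
      unfolding of_nat_sum by (intro sum_mono floor_n)
    moreover have "(\<Sum>h\<in>S - {g0}. m * pmf \<mu> h - 1) = m * (1 - pmf \<mu> g0) - real (card (S - {g0}))"
      using split sum_pmf by (simp add: sum_subtractf sum_distrib_left[symmetric])
    moreover have "real (card (S - {g0})) \<le> card S"
      using card_mono[OF S(1), of "S - {g0}"] by auto
    moreover have "real (n g0) = m - real (\<Sum>h\<in>S - {g0}. nat \<lfloor>m * pmf \<mu> h\<rfloor>)"
      using rest_le by (simp add: n_def of_nat_diff)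
    ultimately show ?thesis
      using rest True by (simp add: algebra_simps abs_le_iff)
  qed
  \<comment> \<open>listing each \<open>g\<close> with multiplicity \<open>n g\<close>\<close>
  define I where "I = (SIGMA g:S. {..<n g})"
  have "finite I" "card I = m"
    using S(1) sum_n by (auto simp: I_def)
  then obtain h where h: "bij_betw h {0..<m} I"
    using ex_bij_betw_nat_finite by metis
  have sum_h: "(\<Sum>i<m. f (fst (h i)) a) = (\<Sum>g\<in>S. real (n g) *\<^sub>R f g a)" for a
  proof -
    have "(\<Sum>i<m. f (fst (h i)) a) = (\<Sum>x\<in>I. f (fst x) a)"
      using sum.reindex_bij_betw[OF h, of "\<lambda>x. f (fst x) a"] by (simp add: atLeast0LessThan)
    also have "\<dots> = (\<Sum>g\<in>S. \<Sum>j<n g. f g a)"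
      unfolding I_def using S(1) by (subst sum.Sigma) (auto simp: case_prod_beta)
    finally show ?thesis
      by (simp add: scaleR_conv_of_real sum_constant_scaleR)
  qed
  show thesis
  proof (rule that[OF m0, of "fst \<circ> h"])
    show "(fst \<circ> h) i \<in> set_pmf \<mu>" if "i < m" for i
    proof -
      have "h i \<in> I"
        using bij_betwE[OF h] that by simp
      then show ?thesis
        by (auto simp: I_def S_def)
    qed
    fix a assume a: "a \<in> F"
    have "(1 / m) *\<^sub>R (\<Sum>i<m. f ((fst \<circ> h) i) a) - (\<Sum>g\<in>S. pmf \<mu> g *\<^sub>R f g a) =
        (\<Sum>g\<in>S. ((real (n g) - m * pmf \<mu> g) / m) *\<^sub>R f g a)"
      using m0 by (simp add: sum_h scaleR_sum_right sum_subtractf[symmetric] scaleR_left_diff_distrib[symmetric] diff_divide_distrib)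
    also have "norm \<dots> \<le> (\<Sum>g\<in>S. norm (((real (n g) - m * pmf \<mu> g) / m) *\<^sub>R f g a))"
      by (rule norm_sum)
    also have "\<dots> \<le> (\<Sum>g\<in>S. card S / m * norm (f g a))"
      using n_close m0 by (intro sum_mono) (auto simp: intro!: mult_right_mono divide_right_mono)
    also have "\<dots> = card S / m * (\<Sum>g\<in>S. norm (f g a))"
      by (simp add: sum_distrib_left)
    also have "\<dots> \<le> card S / m * B"
      using B[OF a] by (intro mult_left_mono) auto
    also have "\<dots> < e"
      using m m0 e by (simp add: field_simps)
    finally show "norm ((1 / m) *\<^sub>R (\<Sum>i<m. f ((fst \<circ> h) i) a) - (\<Sum>g\<in>set_pmf \<mu>. pmf \<mu> g *\<^sub>R f g a)) < e"
      by (simp add: S_def)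
  qed
qed

text \<open>
  The uniform measure on the list \<open>s\<close> approximates a measure provided by the Powers property.  Applying
  the automorphisms \<open>\<alpha> (inv s p)\<close> to the error \<open>b\<close> of this approximation does not increase its norm.
  The set of pairs is symmetric under exchanging \<open>p\<close> and \<open>q\<close>, which inverts \<open>inv s p \<otimes> s q\<close>.
\<close>

lemma powers_state_symmetric_average:
  fixes \<alpha> :: "'g \<Rightarrow> 'a \<Rightarrow> 'a::unital_cstar_algebra"
  assumes G: "group G" and hom: "\<alpha> \<in> hom G cstar_Aut" and P: "powers_state G \<alpha> \<phi>"
    and F: "finite F" and e: "0 < e"
  obtains m :: nat and s where "0 < m" "\<And>i. i < m \<Longrightarrow> s i \<in> carrier G"
    "\<And>a. a \<in> F \<Longrightarrow>
      norm ((1 / (real m * real m)) *\<^sub>R (\<Sum>p<m. \<Sum>q<m. \<alpha> (inv\<^bsub>G\<^esub> s p \<otimes>\<^bsub>G\<^esub> s q) a) - \<phi> a *\<^sub>C 1) < e"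
proof -
  interpret group G
    by fact
  interpret group_hom G cstar_Aut \<alpha>
    by (intro group_hom.intro group_hom_axioms.intro G group_cstar_Aut hom)
  have aut: "star_automorphism (\<alpha> g)" if "g \<in> carrier G" for g
    using hom_closed[OF that] by (simp add: cstar_Aut_def)
  have mult: "\<alpha> (g \<otimes>\<^bsub>G\<^esub> h) a = \<alpha> g (\<alpha> h a)" if "g \<in> carrier G" "h \<in> carrier G" for g h a
    using hom_mult[OF that] by (simp add: cstar_Aut_def)
  obtain \<mu> where \<mu>: "finite (set_pmf \<mu>)" "set_pmf \<mu> \<subseteq> carrier G"
    "\<And>a. a \<in> F \<Longrightarrow> norm ((\<Sum>g\<in>set_pmf \<mu>. pmf \<mu> g *\<^sub>R \<alpha> g a) - \<phi> a *\<^sub>C 1) < e / 2"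
    using P F e unfolding powers_state_def by (meson half_gt_zero)
  have "e / 2 > 0"
    using e by simp
  then obtain m :: nat and s where m: "0 < m" and s_supp: "\<And>i. i < m \<Longrightarrow> s i \<in> set_pmf \<mu>"
    and approx: "\<And>a. a \<in> F \<Longrightarrow>
      norm ((1 / m) *\<^sub>R (\<Sum>i<m. \<alpha> (s i) a) - (\<Sum>g\<in>set_pmf \<mu>. pmf \<mu> g *\<^sub>R \<alpha> g a)) < e / 2"
    using pmf_uniform_approximation[OF \<mu>(1) F, of "e / 2" \<alpha>] by metis
  have s: "s i \<in> carrier G" if "i < m" for i
    using s_supp \<mu>(2) that by blast
  show thesis
  proof (rule that[OF m s])
    fix a assume a: "a \<in> F"
    define b where "b = (1 / m) *\<^sub>R (\<Sum>q<m. \<alpha> (s q) a) - \<phi> a *\<^sub>C 1"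
    have b: "norm b < e"
      using norm_triangle_lt[of "(1 / m) *\<^sub>R (\<Sum>i<m. \<alpha> (s i) a) - (\<Sum>g\<in>set_pmf \<mu>. pmf \<mu> g *\<^sub>R \<alpha> g a)"
          "(\<Sum>g\<in>set_pmf \<mu>. pmf \<mu> g *\<^sub>R \<alpha> g a) - \<phi> a *\<^sub>C 1" e] approx[OF a] \<mu>(3)[OF a]
      by (simp add: b_def)
    have expand: "\<alpha> (inv\<^bsub>G\<^esub> s p) b = (1 / m) *\<^sub>R (\<Sum>q<m. \<alpha> (inv\<^bsub>G\<^esub> s p \<otimes>\<^bsub>G\<^esub> s q) a) - \<phi> a *\<^sub>C 1"
      if "p < m" for p
    proof -
      note A = star_automorphismD[OF aut, of "inv\<^bsub>G\<^esub> s p"]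
      have p: "inv\<^bsub>G\<^esub> s p \<in> carrier G"
        using s that by simp
      have "\<alpha> (inv\<^bsub>G\<^esub> s p) (\<Sum>q<k. \<alpha> (s q) a) = (\<Sum>q<k. \<alpha> (inv\<^bsub>G\<^esub> s p \<otimes>\<^bsub>G\<^esub> s q) a)" if "k \<le> m" for k
        using that
      proof (induction k)
        case 0
        then show ?case
          using A(5)[OF p, of 0 0] by simp
      next
        case (Suc k)
        then show ?case
          using s p by (simp add: A(1) mult del: hom_mult)
      qed
      then show ?thesis
        using p by (simp add: b_def A)
    qed
    have "(1 / (real m * real m)) *\<^sub>R (\<Sum>p<m. \<Sum>q<m. \<alpha> (inv\<^bsub>G\<^esub> s p \<otimes>\<^bsub>G\<^esub> s q) a) - \<phi> a *\<^sub>C 1 =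
        (1 / m) *\<^sub>R (\<Sum>p<m. \<alpha> (inv\<^bsub>G\<^esub> s p) b)"
      using m by (simp add: expand sum_subtractf scaleR_sum_right[symmetric] scaleR_diff_right
          sum_constant_scaleR del: sum_constant)
    moreover have "norm (\<Sum>p<m. \<alpha> (inv\<^bsub>G\<^esub> s p) b) \<le> (\<Sum>p<m. norm b)"
    proof (rule sum_norm_le)
      fix p assume "p \<in> {..<m}"
      then show "norm (\<alpha> (inv\<^bsub>G\<^esub> s p) b) \<le> norm b"
        using s by (intro star_automorphism_norm_le aut) auto
    qed
    then have "norm ((1 / m) *\<^sub>R (\<Sum>p<m. \<alpha> (inv\<^bsub>G\<^esub> s p) b)) \<le> norm b"
      using m by (simp add: field_simps del: hom_inv)
    ultimately show "norm ((1 / (real m * real m)) *\<^sub>R (\<Sum>p<m. \<Sum>q<m. \<alpha> (inv\<^bsub>G\<^esub> s p \<otimes>\<^bsub>G\<^esub> s q) a) - \<phi> a *\<^sub>C 1) < e"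
      using b by simp
  qed
qed

section \<open>Ping-pong and the PHP property\<close>

text \<open>
  Conjugating a single ping-pong element by the translations \<open>w i\<close> yields \<open>n\<close> ping-pong elements, and
  multiplying from both sides by \<open>x i\<close> and \<open>y i\<close> only translates the two shadows.  All sets of the family
  are therefore contained in translates \<open>u <# A\<close> and \<open>u <# B\<close>, and two different \<open>u\<close> that occur differ by
  an element of the finite set \<open>F2\<close>, for which the ping-pong element was chosen.  Adjoining \<open>\<one>\<close> to \<open>F\<close>
  gives the bound for the cardinality as a special case of disjointness.
\<close>

lemma (in acylindrical_group_metric) ping_pong_families:
  fixes n :: nat
  assumes K: "K \<lhd> G" "K \<noteq> {\<one>}" and F: "finite F" "F \<subseteq> carrier G"
    and xy: "x \<in> {1..n} \<rightarrow> carrier G" "y \<in> {1..n} \<rightarrow> carrier G"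
  shows "\<exists>\<kappa> C. (\<forall>i\<in>{1..n}. \<kappa> i \<in> K \<and> C i \<subseteq> carrier G) \<and>
    disjoint_family_on
      (case_sum (\<lambda>(g, i). g <# C i) (\<lambda>(h, j). (h \<otimes> inv (x j \<otimes> \<kappa> j \<otimes> y j)) <# (carrier G - C j)))
      ((F \<times> {1..n}) <+> (F \<times> {1..n})) \<and>
    (\<forall>g. card ({i\<in>{1..n}. g \<in> C i} \<union>
      {j\<in>{1..n}. g \<in> inv (x j \<otimes> \<kappa> j \<otimes> y j) <# (carrier G - C j)}) \<le> 2)"
proof -
  have x: "x i \<in> carrier G" and y: "y i \<in> carrier G" if "i \<in> {1..n}" for i
    using xy that by auto
  define F1 where "F1 = insert \<one> F"
  have F1: "finite F1" "F1 \<subseteq> carrier G"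
    using F by (auto simp: F1_def)
  define E where "E = (\<lambda>(g, i). g \<otimes> x i) ` (F1 \<times> {1..n}) \<union> (\<lambda>(g, i). g \<otimes> inv (y i)) ` (F1 \<times> {1..n})"
  have E: "finite E" "E \<subseteq> carrier G"
    using F1 x y by (auto simp: E_def)
  have E_x: "g \<otimes> x i \<in> E" and E_y: "g \<otimes> inv (y i) \<in> E" if "g \<in> F1" "i \<in> {1..n}" for g i
    using that by (auto simp: E_def)
  obtain w where w: "\<And>i. w i \<in> carrier G"
    and sep: "\<And>i j e e'. \<lbrakk>i \<in> {1..n}; j \<in> {1..n}; i \<noteq> j; e \<in> E; e' \<in> E\<rbrakk> \<Longrightarrow> e \<otimes> w i \<noteq> e' \<otimes> w j"
    using separating_translations[OF infinite_carrier E, of n] by blast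
  define W where "W = (\<lambda>(e, i). e \<otimes> w i) ` (E \<times> {1..n})"
  define F2 where "F2 = (\<lambda>(v, u). inv v \<otimes> u) ` (W \<times> W) - {\<one>}"
  have W: "finite W" "W \<subseteq> carrier G"
    using E w by (auto simp: W_def)
  then have F2: "finite F2" "F2 \<subseteq> carrier G - {\<one>}"
    by (auto simp: F2_def)
  obtain k A B where k: "k \<in> K" and AB: "A \<subseteq> carrier G" "B \<subseteq> carrier G" "A \<inter> B = {}"
    and ping: "\<And>z. \<lbrakk>z \<in> carrier G; z \<notin> B\<rbrakk> \<Longrightarrow> k \<otimes> z \<in> A"
    and pong: "\<And>f a b. \<lbrakk>f \<in> F2; a \<in> A \<union> B; b \<in> A \<union> B\<rbrakk> \<Longrightarrow> f \<otimes> a \<noteq> b"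
    using normal_subgroup_ping_pong[OF K F2] by metis
  have kG: "k \<in> carrier G"
    using normal_imp_subgroup[OF K(1)] subgroup.mem_carrier k by metis
  have core: "e = e' \<and> i = j \<and> a = b"
    if "e \<in> E" "e' \<in> E" "i \<in> {1..n}" "j \<in> {1..n}" "a \<in> A \<union> B" "b \<in> A \<union> B"
      and eq: "e \<otimes> w i \<otimes> a = e' \<otimes> w j \<otimes> b" for e e' i j a b
  proof -
    define u v where "u = e \<otimes> w i" and "v = e' \<otimes> w j"
    have uv: "u \<in> W" "v \<in> W"
      using that by (auto simp: u_def v_def W_def)
    have carr: "u \<in> carrier G" "v \<in> carrier G" "a \<in> carrier G" "b \<in> carrier G"
        "e \<in> carrier G" "e' \<in> carrier G"
      using uv W that AB E by auto
    have "inv v \<otimes> u \<otimes> a = b"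
      using eq carr by (simp add: u_def[symmetric] v_def[symmetric] m_assoc inv_cancel)
    then have "inv v \<otimes> u \<notin> F2"
      using pong that by blast
    moreover have "inv v \<otimes> u \<in> (\<lambda>(v, u). inv v \<otimes> u) ` (W \<times> W)"
      using uv by (intro image_eqI[of _ _ "(v, u)"]) auto
    ultimately have "inv v \<otimes> u = \<one>"
      by (auto simp: F2_def)
    then have "u = v"
      using carr by (metis inv_equality inv_inv inv_closed)
    moreover have "i = j"
      using sep[OF that(3,4) _ that(1,2)] \<open>u = v\<close> by (auto simp: u_def v_def)
    ultimately show ?thesis
      using eq carr w by (auto simp: u_def v_def)
  qed
  define \<kappa> where "\<kappa> i = w i \<otimes> k \<otimes> inv (w i)" for i
  define C where "C i = (x i \<otimes> w i) <# A" for i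
  define t where "t i = x i \<otimes> \<kappa> i \<otimes> y i" for i
  have \<kappa>K: "\<kappa> i \<in> K" for i
    unfolding \<kappa>_def using normal.inv_op_closed2[OF K(1) w k] .
  have t: "t i \<in> carrier G" if "i \<in> {1..n}" for i
    using x y w kG that by (simp add: t_def \<kappa>_def)
  have CG: "C i \<subseteq> carrier G" if "i \<in> {1..n}" for i
    unfolding C_def using x w AB that by (intro l_coset_subset_G) auto
  have in_C: "\<exists>a\<in>A. z = g \<otimes> x i \<otimes> w i \<otimes> a" if z: "z \<in> g <# C i" and "g \<in> F1" "i \<in> {1..n}" for z g i
  proof -
    have "g \<in> carrier G"
      using that F1 by blast
    moreover obtain a where "a \<in> A" "z = g \<otimes> (x i \<otimes> w i \<otimes> a)"
      using z unfolding C_def l_coset_def by blast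
    ultimately show ?thesis
      using x w AB that by (auto simp: m_assoc subsetD)
  qed
  \<comment> \<open>the contrapositive of the ping-pong condition: \<open>inv k\<close> maps the complement of \<open>A\<close> into \<open>B\<close>\<close>
  have in_D: "\<exists>b\<in>B. z = g \<otimes> inv (y i) \<otimes> w i \<otimes> b"
    if z: "z \<in> (g \<otimes> inv (t i)) <# (carrier G - C i)" and "g \<in> F1" "i \<in> {1..n}" for z g i
  proof -
    have g: "g \<in> carrier G"
      using that F1 by blast
    have xyi: "x i \<in> carrier G" "y i \<in> carrier G" "w i \<in> carrier G"
      using x y w that by auto
    obtain v where v: "v \<in> carrier G" "v \<notin> C i" "z = g \<otimes> inv (t i) \<otimes> v"
      using z by (auto simp: l_coset_def)
    define v' where "v' = inv (x i \<otimes> w i) \<otimes> v"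
    have v': "v' \<in> carrier G" "v' \<notin> A"
      using v xyi AB by (auto simp: v'_def C_def mem_l_coset_iff)
    have "inv k \<otimes> v' \<in> B"
    proof (rule ccontr)
      assume "inv k \<otimes> v' \<notin> B"
      then have "k \<otimes> (inv k \<otimes> v') \<in> A"
        using ping kG v' by simp
      then show False
        using v' kG by (simp add: inv_cancel)
    qed
    moreover have "z = g \<otimes> inv (y i) \<otimes> w i \<otimes> (inv k \<otimes> v')"
      using v g xyi kG by (simp add: t_def \<kappa>_def v'_def inv_mult_group m_assoc)
    ultimately show ?thesis
      by blast
  qed
  have FF1: "g \<in> F1" if "g \<in> F" for g
    using that by (simp add: F1_def)
  have cancel: "g = h" if "g \<otimes> u = h \<otimes> u" "g \<in> F1" "h \<in> F1" "u \<in> carrier G" for g h u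
    using that F1 by (metis right_cancel subsetD)
  have CC: "g = h \<and> i = j"
    if H: "z \<in> g <# C i" "z \<in> h <# C j" "g \<in> F1" "h \<in> F1" "i \<in> {1..n}" "j \<in> {1..n}" for z g h i j
  proof -
    obtain a b where "a \<in> A" "b \<in> A" "g \<otimes> x i \<otimes> w i \<otimes> a = h \<otimes> x j \<otimes> w j \<otimes> b"
      using in_C[OF H(1,3,5)] in_C[OF H(2,4,6)] by metis
    then have "g \<otimes> x i = h \<otimes> x j \<and> i = j"
      using core[OF E_x E_x] H by blast
    then show ?thesis
      using cancel x H by metis
  qed
  have DD: "g = h \<and> i = j"
    if H: "z \<in> (g \<otimes> inv (t i)) <# (carrier G - C i)" "z \<in> (h \<otimes> inv (t j)) <# (carrier G - C j)"
      "g \<in> F1" "h \<in> F1" "i \<in> {1..n}" "j \<in> {1..n}" for z g h i j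
  proof -
    obtain a b where "a \<in> B" "b \<in> B" "g \<otimes> inv (y i) \<otimes> w i \<otimes> a = h \<otimes> inv (y j) \<otimes> w j \<otimes> b"
      using in_D[OF H(1,3,5)] in_D[OF H(2,4,6)] by metis
    then have "g \<otimes> inv (y i) = h \<otimes> inv (y j) \<and> i = j"
      using core[OF E_y E_y] H by blast
    then show ?thesis
      using cancel y H by (metis inv_closed)
  qed
  have CD: False
    if H: "z \<in> g <# C i" "z \<in> (h \<otimes> inv (t j)) <# (carrier G - C j)"
      "g \<in> F1" "h \<in> F1" "i \<in> {1..n}" "j \<in> {1..n}" for z g h i j
  proof -
    obtain a b where ab: "a \<in> A" "b \<in> B" "g \<otimes> x i \<otimes> w i \<otimes> a = h \<otimes> inv (y j) \<otimes> w j \<otimes> b"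
      using in_C[OF H(1,3,5)] in_D[OF H(2,4,6)] by metis
    then have "a = b"
      using core[OF E_x E_y] H by blast
    then show False
      using ab AB by blast
  qed
  have disj: "disjoint_family_on
      (case_sum (\<lambda>(g, i). g <# C i) (\<lambda>(h, j). (h \<otimes> inv (t j)) <# (carrier G - C j)))
      ((F \<times> {1..n}) <+> (F \<times> {1..n}))"
    unfolding disjoint_family_on_def
  proof (intro ballI impI)
    fix p q
    assume pq: "p \<in> (F \<times> {1..n}) <+> (F \<times> {1..n})" "q \<in> (F \<times> {1..n}) <+> (F \<times> {1..n})" "p \<noteq> q"
    let ?S = "case_sum (\<lambda>(g, i). g <# C i) (\<lambda>(h, j). (h \<otimes> inv (t j)) <# (carrier G - C j))"
    have False if z: "z \<in> ?S p" "z \<in> ?S q" for z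
    proof -
      from pq(1) obtain g i where p: "g \<in> F1" "i \<in> {1..n}" "p = Inl (g, i) \<or> p = Inr (g, i)"
        using FF1 by blast
      from pq(2) obtain h j where q: "h \<in> F1" "j \<in> {1..n}" "q = Inl (h, j) \<or> q = Inr (h, j)"
        using FF1 by blast
      consider "p = Inl (g, i)" "q = Inl (h, j)" | "p = Inr (g, i)" "q = Inr (h, j)"
        | "p = Inl (g, i)" "q = Inr (h, j)" | "p = Inr (g, i)" "q = Inl (h, j)"
        using p(3) q(3) by blast
      then show False
      proof cases
        case 1
        then show False
          using z pq(3) CC[OF _ _ p(1) q(1) p(2) q(2), of z] by simp
      next
        case 2
        then show False
          using z pq(3) DD[OF _ _ p(1) q(1) p(2) q(2), of z] by simp
      next
        case 3
        then show False
          using z CD[OF _ _ p(1) q(1) p(2) q(2), of z] by simp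
      next
        case 4
        then show False
          using z CD[OF _ _ q(1) p(1) q(2) p(2), of z] by simp
      qed
    qed
    then show "?S p \<inter> ?S q = {}"
      by blast
  qed
  have one_C: "\<one> <# C i = C i" and one_D: "\<one> \<otimes> inv (t i) = inv (t i)" if "i \<in> {1..n}" for i
    using lcos_mult_one[OF CG[OF that]] t[OF that] by auto
  have count: "card ({i\<in>{1..n}. g \<in> C i} \<union> {j\<in>{1..n}. g \<in> inv (t j) <# (carrier G - C j)}) \<le> 2" for g
  proof -
    have "card {i\<in>{1..n}. g \<in> C i} \<le> Suc 0"
      using CC[of g \<one> _ \<one>] one_C by (auto simp: card_le_Suc0_iff_eq F1_def)
    moreover have "card {j\<in>{1..n}. g \<in> inv (t j) <# (carrier G - C j)} \<le> Suc 0"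
      using DD[of g \<one> _ \<one>] one_D by (auto simp: card_le_Suc0_iff_eq F1_def)
    ultimately show ?thesis
      using card_Un_le[of "{i\<in>{1..n}. g \<in> C i}" "{j\<in>{1..n}. g \<in> inv (t j) <# (carrier G - C j)}"]
      by linarith
  qed
  show ?thesis
    using \<kappa>K CG disj count unfolding t_def by (intro exI[of _ \<kappa>] exI[of _ C] conjI ballI allI)
qed

theorem theorem4p4:
  fixes G :: "('g, 'm) monoid_scheme"
    and \<alpha> :: "'g \<Rightarrow> 'a \<Rightarrow> 'a::unital_cstar_algebra"
    and \<phi> :: "'a \<Rightarrow> complex"
  assumes "group G"
    and "acylindrically_hyperbolic TYPE('x) G"
    and "is_finite_radical G {\<one>\<^bsub>G\<^esub>}"
    and "\<alpha> \<in> hom G cstar_Aut"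
    and "powers_state G \<alpha> \<phi>"
    and "kernel G cstar_Aut \<alpha> \<noteq> {\<one>\<^bsub>G\<^esub>}"
  shows "PHP_property G \<alpha> \<phi>"
  unfolding PHP_property_def
proof (intro allI impI, elim conjE)
  fix F\<^sub>A :: "'a set" and F\<^sub>G and N :: nat and \<epsilon> :: real
  assume F: "finite F\<^sub>A" "finite F\<^sub>G" "F\<^sub>G \<subseteq> carrier G" and \<epsilon>: "\<epsilon> > 0"
  obtain D \<delta> where "acylindrical_group_metric G D \<delta>"
    using acylindrically_hyperbolic_group_metric[OF assms(1-3)] by blast
  then interpret acylindrical_group_metric G D \<delta> .
  interpret group_hom G cstar_Aut \<alpha>
    by (intro group_hom.intro group_hom_axioms.intro assms group_cstar_Aut)
  note hom_mult [simp del] and hom_inv [simp del]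
  define K where "K = kernel G cstar_Aut \<alpha>"
  have K: "K \<lhd> G" "K \<noteq> {\<one>\<^bsub>G\<^esub>}"
    using normal_kernel assms(6) by (simp_all add: K_def)
  have \<alpha>_K: "\<alpha> k a = a" and KG: "k \<in> carrier G" if "k \<in> K" for k a
    using that by (auto simp: K_def kernel_def cstar_Aut_def)
  have \<alpha>_mult: "\<alpha> (g \<otimes>\<^bsub>G\<^esub> h) a = \<alpha> g (\<alpha> h a)" if "g \<in> carrier G" "h \<in> carrier G" for g h a
    using hom_mult[OF that] by (simp add: cstar_Aut_def)
  have \<alpha>_inv: "inv_into UNIV (\<alpha> g) a = \<alpha> (inv\<^bsub>G\<^esub> g) a" if g: "g \<in> carrier G" for g a
  proof (rule inv_f_eq)
    show "inj (\<alpha> g)"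
      using hom_closed[OF g] by (simp add: cstar_Aut_def star_automorphism_def bij_is_inj)
    have "\<alpha> g (\<alpha> (inv\<^bsub>G\<^esub> g) a) = \<alpha> \<one>\<^bsub>G\<^esub> a"
      using \<alpha>_mult[of g "inv\<^bsub>G\<^esub> g" a] g by simp
    then show "\<alpha> g (\<alpha> (inv\<^bsub>G\<^esub> g) a) = a"
      using hom_one by (simp add: cstar_Aut_def)
  qed
  obtain m :: nat and s where m: "0 < m" and s: "\<And>i. i < m \<Longrightarrow> s i \<in> carrier G"
    and avg: "\<And>a. a \<in> F\<^sub>A \<Longrightarrow>
      norm ((1 / (real m * real m)) *\<^sub>R (\<Sum>p<m. \<Sum>q<m. \<alpha> (inv\<^bsub>G\<^esub> s p \<otimes>\<^bsub>G\<^esub> s q) a) - \<phi> a *\<^sub>C 1) < \<epsilon>"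
    using powers_state_symmetric_average[OF assms(1,4,5) F(1) \<epsilon>] by metis
  \<comment> \<open>all pairs from the list are repeated \<open>R\<close> times, so that \<open>n\<close> exceeds \<open>N\<close> and \<open>2 \<le> \<epsilon> \<surd>n\<close>\<close>
  define R where "R = N + nat \<lceil>4 / \<epsilon>\<^sup>2\<rceil> + 1"
  define n where "n = m * m * R"
  define I where "I = {..<m} \<times> {..<m} \<times> {..<R}"
  have I: "finite I" "card I = n"
    by (simp_all add: I_def n_def)
  obtain \<iota> where \<iota>: "bij_betw \<iota> {1..n} I"
    using ex_bij_betw_nat_finite_1[OF I(1)] I(2) by metis
  define p q where "p i = fst (\<iota> i)" and "q i = fst (snd (\<iota> i))" for i
  have pq: "p i < m" "q i < m" if "i \<in> {1..n}" for i
  proof -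
    have "\<iota> i \<in> I"
      using \<iota> that by (auto simp: bij_betw_def)
    then show "p i < m" "q i < m"
      by (auto simp: I_def p_def q_def)
  qed
  have xG: "inv\<^bsub>G\<^esub> s (p i) \<in> carrier G" and yG: "s (q i) \<in> carrier G" and pG: "s (p i) \<in> carrier G"
    if "i \<in> {1..n}" for i
    using s pq[OF that] by auto
  have xyG: "(\<lambda>i. inv\<^bsub>G\<^esub> s (p i)) \<in> {1..n} \<rightarrow> carrier G" "(\<lambda>i. s (q i)) \<in> {1..n} \<rightarrow> carrier G"
    using xG yG by auto
  obtain \<kappa> C where *: "(\<forall>i\<in>{1..n}. \<kappa> i \<in> K \<and> C i \<subseteq> carrier G) \<and>
    disjoint_family_on
      (case_sum (\<lambda>(g, i). g <#\<^bsub>G\<^esub> C i)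
        (\<lambda>(h, j). (h \<otimes>\<^bsub>G\<^esub> inv\<^bsub>G\<^esub> (inv\<^bsub>G\<^esub> s (p j) \<otimes>\<^bsub>G\<^esub> \<kappa> j \<otimes>\<^bsub>G\<^esub> s (q j))) <#\<^bsub>G\<^esub> (carrier G - C j)))
      ((F\<^sub>G \<times> {1..n}) <+> (F\<^sub>G \<times> {1..n})) \<and>
    (\<forall>g. card ({i\<in>{1..n}. g \<in> C i} \<union>
      {j\<in>{1..n}. g \<in> inv\<^bsub>G\<^esub> (inv\<^bsub>G\<^esub> s (p j) \<otimes>\<^bsub>G\<^esub> \<kappa> j \<otimes>\<^bsub>G\<^esub> s (q j)) <#\<^bsub>G\<^esub> (carrier G - C j)}) \<le> 2)"
    using ping_pong_families[where x = "\<lambda>i. inv\<^bsub>G\<^esub> s (p i)" and y = "\<lambda>i. s (q i)" and n = n,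
        OF K F(2,3) xyG] by (elim exE)
  define t where "t i = inv\<^bsub>G\<^esub> s (p i) \<otimes>\<^bsub>G\<^esub> \<kappa> i \<otimes>\<^bsub>G\<^esub> s (q i)" for i
  have \<kappa>: "\<kappa> i \<in> K" and C: "C i \<subseteq> carrier G" if "i \<in> {1..n}" for i
    using * that by auto
  have disj: "disjoint_family_on
      (case_sum (\<lambda>(g, i). g <#\<^bsub>G\<^esub> C i)
        (\<lambda>(h, j). (h \<otimes>\<^bsub>G\<^esub> inv\<^bsub>G\<^esub> t j) <#\<^bsub>G\<^esub> (carrier G - C j)))
      ((F\<^sub>G \<times> {1..n}) <+> (F\<^sub>G \<times> {1..n}))"
    and count: "\<And>g. card ({i\<in>{1..n}. g \<in> C i} \<union>
      {j\<in>{1..n}. g \<in> inv\<^bsub>G\<^esub> t j <#\<^bsub>G\<^esub> (carrier G - C j)}) \<le> 2"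
    using * unfolding t_def by simp_all
  have tG: "t i \<in> carrier G" if "i \<in> {1..n}" for i
    using xG[OF that] yG[OF that] KG[OF \<kappa>[OF that]] by (simp add: t_def)
  define E where "E a p q = \<alpha> (inv\<^bsub>G\<^esub> s p \<otimes>\<^bsub>G\<^esub> s q) a" for a p q
  have \<alpha>_t: "\<alpha> (t i) a = E a (p i) (q i)" if i: "i \<in> {1..n}" for i a
    using xG[OF i] yG[OF i] \<kappa>[OF i] KG[OF \<kappa>[OF i]] by (simp add: t_def E_def \<alpha>_mult \<alpha>_K)
  have \<alpha>_t': "inv_into UNIV (\<alpha> (t i)) a = E a (q i) (p i)" if i: "i \<in> {1..n}" for i a
  proof -
    have "\<kappa> i \<in> K" "inv\<^bsub>G\<^esub> (\<kappa> i) \<in> K"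
      using \<kappa>[OF i] normal_imp_subgroup[OF K(1)] by (simp_all add: subgroup.m_inv_closed)
    moreover from this have "\<kappa> i \<in> carrier G"
      using KG by blast
    moreover from this have "inv\<^bsub>G\<^esub> t i = inv\<^bsub>G\<^esub> s (q i) \<otimes>\<^bsub>G\<^esub> (inv\<^bsub>G\<^esub> \<kappa> i \<otimes>\<^bsub>G\<^esub> s (p i))"
      using pG[OF i] yG[OF i] by (simp add: t_def group.inv_mult_group[OF assms(1)])
    ultimately show ?thesis
      using pG[OF i] yG[OF i] by (simp add: \<alpha>_inv[OF tG[OF i]] E_def \<alpha>_mult \<alpha>_K)
  qed
  have sum_I: "(\<Sum>i=1..n. h (p i) (q i)) = real R *\<^sub>R (\<Sum>p<m. \<Sum>q<m. h p q)" for h :: "nat \<Rightarrow> nat \<Rightarrow> 'a"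
  proof -
    have "(\<Sum>i=1..n. h (p i) (q i)) = (\<Sum>x\<in>I. h (fst x) (fst (snd x)))"
      unfolding p_def q_def using sum.reindex_bij_betw[OF \<iota>, of "\<lambda>x. h (fst x) (fst (snd x))"] by simp
    also have "\<dots> = (\<Sum>p<m. \<Sum>z\<in>{..<m} \<times> {..<R}. h p (fst z))"
      by (simp add: I_def sum.cartesian_product case_prod_beta)
    also have "\<dots> = (\<Sum>p<m. \<Sum>q<m. \<Sum>r<R. h p q)"
      by (intro sum.cong refl) (simp add: sum.cartesian_product case_prod_beta del: sum_constant)
    finally show ?thesis
      by (simp add: sum_constant_scaleR scaleR_sum_right del: sum_constant)
  qed
  have R: "R > 0" "N \<le> R" "4 / \<epsilon>\<^sup>2 \<le> real R"
    unfolding R_def by linarith+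
  have "R \<le> n"
    using m by (simp add: n_def)
  then have n: "0 < n" "N \<le> n" "4 / \<epsilon>\<^sup>2 \<le> real n"
    using R by linarith+
  have "2 = \<epsilon> * sqrt (4 / \<epsilon>\<^sup>2)"
    using \<epsilon> by (simp add: real_sqrt_divide)
  also have "\<dots> \<le> \<epsilon> * sqrt n"
    using n(3) \<epsilon> by simp
  finally have two: "2 \<le> \<epsilon> * sqrt n" .
  have mean: "norm ((1 / (2 * real n)) *\<^sub>R
      (\<Sum>i=1..n. \<alpha> (t i) a + inv_into UNIV (\<alpha> (t i)) a) - \<phi> a *\<^sub>C 1) < \<epsilon>" if a: "a \<in> F\<^sub>A" for a
  proof -
    define Z where "Z = (\<Sum>p<m. \<Sum>q<m. E a p q)"
    have "(\<Sum>i=1..n. \<alpha> (t i) a + inv_into UNIV (\<alpha> (t i)) a) =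
        (\<Sum>i=1..n. E a (p i) (q i)) + (\<Sum>i=1..n. E a (q i) (p i))"
      by (simp add: \<alpha>_t \<alpha>_t' sum.distrib)
    also have "\<dots> = real R *\<^sub>R Z + real R *\<^sub>R (\<Sum>p<m. \<Sum>q<m. E a q p)"
      unfolding Z_def using sum_I[of "E a"] sum_I[of "\<lambda>p q. E a q p"] by simp
    also have "(\<Sum>p<m. \<Sum>q<m. E a q p) = Z"
      unfolding Z_def by (rule sum.swap)
    finally have "(\<Sum>i=1..n. \<alpha> (t i) a + inv_into UNIV (\<alpha> (t i)) a) = (2 * real R) *\<^sub>R Z"
      by (simp add: scaleR_2[symmetric])
    then have "(1 / (2 * real n)) *\<^sub>R (\<Sum>i=1..n. \<alpha> (t i) a + inv_into UNIV (\<alpha> (t i)) a) = (1 / (real m * real m)) *\<^sub>R Z"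
      using R(1) m by (simp add: n_def)
    then show ?thesis
      using avg[OF a] by (simp add: Z_def E_def)
  qed
  show "\<exists>n\<ge>N. \<exists>(t :: nat \<Rightarrow> 'g) C D.
          (\<forall>i\<in>{1..n}. t i \<in> carrier G \<and> C i \<subseteq> D i \<and> D i \<subseteq> carrier G) \<and>
          disjoint_family_on
            (case_sum (\<lambda>(g, i). g <#\<^bsub>G\<^esub> C i)
               (\<lambda>(h, j). (h \<otimes>\<^bsub>G\<^esub> inv\<^bsub>G\<^esub> t j) <#\<^bsub>G\<^esub> (carrier G - D j)))
            ((F\<^sub>G \<times> {1..n}) <+> (F\<^sub>G \<times> {1..n})) \<and>
          (\<forall>g\<in>carrier G.
             real (card ({i\<in>{1..n}. g \<in> D i} \<union>
                         {j\<in>{1..n}. g \<in> inv\<^bsub>G\<^esub> t j <#\<^bsub>G\<^esub> (carrier G - C j)}))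
               \<le> \<epsilon> * sqrt (real n)) \<and>
          (\<forall>a\<in>F\<^sub>A. norm ((1 / (2 * real n)) *\<^sub>R
                      (\<Sum>i=1..n. \<alpha> (t i) a + inv_into UNIV (\<alpha> (t i)) a) - \<phi> a *\<^sub>C 1) < \<epsilon>)"
  proof (intro exI[of _ n] exI[of _ t] exI[of _ C] conjI ballI)
    show "N \<le> n"
      by fact
    show "t i \<in> carrier G" "C i \<subseteq> C i" "C i \<subseteq> carrier G" if "i \<in> {1..n}" for i
      using that tG C by auto
    show "disjoint_family_on
            (case_sum (\<lambda>(g, i). g <#\<^bsub>G\<^esub> C i)
               (\<lambda>(h, j). (h \<otimes>\<^bsub>G\<^esub> inv\<^bsub>G\<^esub> t j) <#\<^bsub>G\<^esub> (carrier G - C j)))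
            ((F\<^sub>G \<times> {1..n}) <+> (F\<^sub>G \<times> {1..n}))"
      by (fact disj)
    show "real (card ({i\<in>{1..n}. g \<in> C i} \<union>
        {j\<in>{1..n}. g \<in> inv\<^bsub>G\<^esub> t j <#\<^bsub>G\<^esub> (carrier G - C j)})) \<le> \<epsilon> * sqrt (real n)" if "g \<in> carrier G" for g
      using count[of g] two by linarith
    show "norm ((1 / (2 * real n)) *\<^sub>R (\<Sum>i=1..n. \<alpha> (t i) a + inv_into UNIV (\<alpha> (t i)) a) - \<phi> a *\<^sub>C 1) < \<epsilon>"
      if "a \<in> F\<^sub>A" for a
      using mean[OF that] .
  qed
qed

end
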